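(* Let $\Omega$ and $\Omega_1,\dots,\Omega_n$ be r.e. infinite sets, and let $P\in\mathbb{P}(\Omega)$ be a discrete probability space on $\Omega$. Let $X_1\colon\Omega\to\Omega_1,\dots,X_n\colon\Omega\to\Omega_n$ be random variables on $\Omega$. Suppose that all of $X_1,\dots,X_n$ are partial recursive functions (the domain of definition of each $X_i$ being precisely $\Omega$). Then the following conditions are equivalent to one another. (i) The random variables $X_1,\dots,X_n$ are independent on $P$. (ii) For every ensemble $\alpha$ for $P$, the ensembles $X_1(\alpha),\dots,X_n(\alpha)$ are independent. (iii) There exists an ensemble $\alpha$ for $P$ such that the ensembles $X_1(\alpha),\dots,X_n(\alpha)$ are independent.
   Context: Alphabets and sequences. $\mathbb{N}^+=\{1,2,3,\dots\}$. For a nonempty set $\Omega$ (alphabet), $\Omega^*$ is the set of finite strings over $\Omega$ (including the empty string $\lambda$), and $\Omega^\infty$ is the set of infinite sequences $\alpha=\alpha(1)\alpha(2)\alpha(3)\cdots$ over $\Omega$; $\alpha\upharpoonright_n$ is the string of the first $n$ elements of $\alpha$. A set $S\subset\Omega^*$ is prefix-free if no string in $S$ is a prefix of another string in $S$. For $S\subset\Omega^*$, $[S]^{\prec}=\{\alpha\in\Omega^\infty\mid \exists n\ge 0,\ \alpha\upharpoonright_n\in S\}$. An r.e. infinite set is an infinite recursively enumerable set (of finite objects usable as Turing machine inputs). Probability spaces. For a countably infinite set $\Omega$, a discrete probability space on $\Omega$ is a function $P\colon\Omega\to\mathbb{R}$ with $P(a)\ge 0$ for all $a$ and $\sum_{a\in\Omega}P(a)=1$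 (no computability is assumed); $\mathbb{P}(\Omega)$ is the set of all of them. For $A\subset\Omega$, $P(A)=\sum_{a\in A}P(a)$. For $\sigma=\sigma_1\cdots\sigma_n\in\Omega^*$, $P(\sigma)=P(\sigma_1)\cdots P(\sigma_n)$ and $P(\lambda)=1$. The generalized Bernoulli measure $\lambda_P$ is the probability measure on the Borel $\sigma$-field of $\Omega^\infty$ (generated by the open sets $[S]^{\prec}$, $S\subset\Omega^*$) determined by $\lambda_P([\{\sigma\}]^{\prec})=P(\sigma)$ for all $\sigma\in\Omega^*$. Ensembles. Let $\Omega$ be an r.e. infinite set and $P\in\mathbb{P}(\Omega)$. A Martin-Löf $P$-test is an r.e. set $\mathcal{C}\subset\mathbb{N}^+\times\Omega^*$ such that for every $n\in\mathbb{N}^+$ the set $\mathcal{C}_n=\{\sigma\mid(n,\sigma)\in\mathcal{C}\}$ is prefix-free and $\lambda_P([\mathcal{C}_n]^{\prec})<2^{-n}$. A sequence $\alpha\in\Omega^\infty$ is Martin-Löf $P$-random if for every Martin-Löf $P$-test $\mathcal{C}$ there is $n\in\mathbb{N}^+$ with $\alpha\notin[\mathcal{C}_n]^{\prec}$. An ensemble for $P$ is a Martin-Löf $P$-random sequence in $\Omega^\infty$. Random variables. A random variable on $\Omega$ is a function $X\colon\Omega\to\Omega'$ with $\Omega'$ countably infinite. $X(P)\in\mathbb{P}(\Omega')$ is given by $X(P)(x)=P(\{a\in\Omega\mid X(a)=x\})$. For $\alpha\in\Omega^\infty$, $X(\alpha)\in(\Omega')^\infty$ is given by $X(\alpha)(k)=X(\alpha(k))$.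 Random variables $X_i\colon\Omega\to\Omega_i$ ($i=1,\dots,n$) are independent on $P$ if $P(\{a\mid X_1(a)=x_1,\dots,X_n(a)=x_n\})=\prod_{i=1}^n P(\{a\mid X_i(a)=x_i\})$ for all $x_1\in\Omega_1,\dots,x_n\in\Omega_n$. Independence of ensembles. For $P_i\in\mathbb{P}(\Omega_i)$, $P_1\times\dots\times P_n\in\mathbb{P}(\Omega_1\times\dots\times\Omega_n)$ is given by $(a_1,\dots,a_n)\mapsto P_1(a_1)\cdots P_n(a_n)$. For $\alpha_i\in\Omega_i^\infty$, $\alpha_1\times\dots\times\alpha_n$ is the sequence over $\Omega_1\times\dots\times\Omega_n$ whose $k$th element is $(\alpha_1(k),\dots,\alpha_n(k))$. Ensembles $\alpha_1,\dots,\alpha_n$ for $P_1,\dots,P_n$, respectively, are independent if $\alpha_1\times\dots\times\alpha_n$ is an ensemble for $P_1\times\dots\times P_n$. In the claim, $X_i(\alpha)$ is regarded as an ensemble for $X_i(P)$. *)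

theory Defs
  imports "HOL-Probability.Probability" "HOL-Library.Nat_Bijection" "HOL-Library.Sublist"
begin

text \<open>
  Codes for Kleene's \<mu>-recursive functions. Arities are left implicit: a code denotes a partial
  function on argument lists of every length, and its restriction to a fixed length is an
  ordinary partial recursive function. The recursion and search variables come first.
\<close>

datatype recf = Zero | Succ | Proj nat | Comp recf "recf list" | PrimRec recf recf | Mu recf

fun eval_recf :: "recf \<Rightarrow> nat list \<Rightarrow> nat option" where
  "eval_recf Zero xs = Some 0"
| "eval_recf Succ xs = (case xs of [x] \<Rightarrow> Some (Suc x) | _ \<Rightarrow> None)"
| "eval_recf (Proj i) xs = (if i < length xs then Some (xs ! i) else None)"
| "eval_recf (Comp f gs) xs =
     (if \<forall>g\<in>set gs. eval_recf g xs \<noteq> None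
      then eval_recf f (map (\<lambda>g. the (eval_recf g xs)) gs) else None)"
| "eval_recf (PrimRec f g) xs =
     (case xs of [] \<Rightarrow> None
      | k # ys \<Rightarrow> rec_nat (eval_recf f ys)
                   (\<lambda>m r. Option.bind r (\<lambda>v. eval_recf g (m # v # ys))) k)"
| "eval_recf (Mu f) xs =
     (if \<exists>z. eval_recf f (z # xs) = Some 0 \<and> (\<forall>y<z. eval_recf f (y # xs) \<noteq> None)
      then Some (LEAST z. eval_recf f (z # xs) = Some 0) else None)"

definition partial_recursive :: "(nat \<rightharpoonup> nat) \<Rightarrow> bool" where
  "partial_recursive f \<longleftrightarrow> (\<exists>c. \<forall>x. f x = eval_recf c [x])"

text \<open>
  Finite objects are handled through an injective coding by natural numbers; recursiveness of
  sets and functions of finite objects refers to the codes. Pairs, tuples and strings of finite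
  objects are coded by the standard computable pairing and list codings.
\<close>

class finite_object =
  fixes encode :: "'a \<Rightarrow> nat"
  assumes inj_encode: "inj encode"

instantiation nat :: finite_object
begin
definition encode_nat :: "nat \<Rightarrow> nat" where "encode_nat x = x"
instance by standard (simp add: encode_nat_def inj_def)
end

instantiation prod :: (finite_object, finite_object) finite_object
begin
definition encode_prod :: "'a \<times> 'b \<Rightarrow> nat" where
  "encode_prod p = prod_encode (encode (fst p), encode (snd p))"
instance
  by standard (auto simp: encode_prod_def inj_def dest: injD[OF inj_encode])
end

instantiation list :: (finite_object) finite_object
begin
definition encode_list :: "'a list \<Rightarrow> nat" where
  "encode_list xs = list_encode (map encode xs)"
instance
  by standard (auto simp: encode_list_def inj_def list_encode_eq dest: map_injective[OF _ inj_encode])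
end

definition re_set :: "'a::finite_object set \<Rightarrow> bool" where
  "re_set A \<longleftrightarrow> (\<exists>f. partial_recursive f \<and> dom f = encode ` A)"

text \<open>The restriction of \<open>X\<close> to \<open>A\<close> is partial recursive with domain of definition exactly \<open>A\<close>.\<close>

definition partial_recursive_on ::
    "'a::finite_object set \<Rightarrow> ('a \<Rightarrow> 'b::finite_object) \<Rightarrow> bool" where
  "partial_recursive_on A X \<longleftrightarrow>
     (\<exists>f. partial_recursive f \<and> dom f = encode ` A \<and>
          (\<forall>a\<in>A. f (encode a) = Some (encode (X a))))"

text \<open>
  The infinite sequence \<open>\<alpha>(1)\<alpha>(2)\<dots>\<close> is represented by a function on \<open>nat\<close> whose value at \<open>k\<close> is
  the element with number \<open>k + 1\<close>.
\<close>

definition infinite_seqs :: "'a set \<Rightarrow> (nat \<Rightarrow> 'a) set" where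
  "infinite_seqs \<Omega> = {\<alpha>. \<forall>k. \<alpha> k \<in> \<Omega>}"

definition initial_segment :: "(nat \<Rightarrow> 'a) \<Rightarrow> nat \<Rightarrow> 'a list" where
  "initial_segment \<alpha> m = map \<alpha> [0..<m]"

definition prefix_free :: "'a list set \<Rightarrow> bool" where
  "prefix_free S \<longleftrightarrow> (\<forall>\<sigma>\<in>S. \<forall>\<tau>\<in>S. prefix \<sigma> \<tau> \<longrightarrow> \<sigma> = \<tau>)"

definition cylinder :: "'a set \<Rightarrow> 'a list set \<Rightarrow> (nat \<Rightarrow> 'a) set" where
  "cylinder \<Omega> S = {\<alpha> \<in> infinite_seqs \<Omega>. \<exists>m. initial_segment \<alpha> m \<in> S}"

text \<open>
  A discrete probability space on \<open>\<Omega>\<close> is a \<open>pmf\<close> on the ambient type that vanishes outside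
  \<open>\<Omega>\<close>. Accordingly its Bernoulli measure lives on all sequences of the ambient type and gives
  measure 1 to \<open>infinite_seqs \<Omega>\<close>.
\<close>

definition discrete_prob_spaces :: "'a set \<Rightarrow> 'a pmf set" where
  "discrete_prob_spaces \<Omega> = {P. set_pmf P \<subseteq> \<Omega>}"

definition bernoulli_measure :: "'a pmf \<Rightarrow> (nat \<Rightarrow> 'a) measure" where
  "bernoulli_measure P = (\<Pi>\<^sub>M k\<in>UNIV. measure_pmf P)"

lemma initial_segment_eq_iff:
  "initial_segment \<alpha> m = \<sigma> \<longleftrightarrow> m = length \<sigma> \<and> (\<forall>k<length \<sigma>. \<alpha> k = \<sigma> ! k)"
  by (auto simp: initial_segment_def list_eq_iff_nth_eq)

lemma cylinder_in_sets:
  fixes \<Omega> :: "'a::finite_object set"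
  shows "cylinder \<Omega> S \<in> sets (bernoulli_measure P)"
proof -
  have sp: "space (bernoulli_measure P) = UNIV"
    by (simp add: bernoulli_measure_def space_PiM)
  have coord: "{\<alpha>. \<alpha> k \<in> A} \<in> sets (bernoulli_measure P)" for k :: nat and A :: "'a set"
  proof -
    have "(\<lambda>\<alpha>. \<alpha> k) \<in> measurable (bernoulli_measure P) (measure_pmf P)"
      unfolding bernoulli_measure_def by (rule measurable_component_singleton) simp
    from measurable_sets[OF this, of A] show ?thesis
      by (simp add: sp vimage_def)
  qed
  have all: "{\<alpha>. \<forall>k\<in>K. \<alpha> k \<in> A k} \<in> sets (bernoulli_measure P)"
    for K :: "nat set" and A :: "nat \<Rightarrow> 'a set"
  proof -
    have "{\<alpha>. \<forall>k\<in>K. \<alpha> k \<in> A k} = (\<Inter>k. if k \<in> K then {\<alpha>. \<alpha> k \<in> A k} else UNIV)"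
      by auto
    also have "\<dots> \<in> sets (bernoulli_measure P)"
      using coord sets.top[of "bernoulli_measure P"] by (intro sets.countable_INT) (auto simp: sp)
    finally show ?thesis .
  qed
  have "countable S"
    by (rule countableI[OF inj_on_subset[OF inj_encode subset_UNIV]])
  have seg: "(\<exists>m. initial_segment \<alpha> m \<in> S) \<longleftrightarrow>
      (\<exists>\<sigma>\<in>S. \<forall>k\<in>{..<length \<sigma>}. \<alpha> k \<in> {\<sigma> ! k})" for \<alpha>
  proof -
    have "(\<exists>m. initial_segment \<alpha> m \<in> S) \<longleftrightarrow> (\<exists>\<sigma>\<in>S. \<exists>m. initial_segment \<alpha> m = \<sigma>)"
      by blast
    then show ?thesis by (simp add: initial_segment_eq_iff Ball_def)
  qed
  have "{\<alpha>. \<exists>m. initial_segment \<alpha> m \<in> S} =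
      (\<Union>\<sigma>\<in>S. {\<alpha>. \<forall>k\<in>{..<length \<sigma>}. \<alpha> k \<in> {\<sigma> ! k}})"
    unfolding seg by blast
  also have "\<dots> \<in> sets (bernoulli_measure P)"
    by (intro sets.countable_UN' \<open>countable S\<close> image_subsetI all)
  finally have "{\<alpha>. \<exists>m. initial_segment \<alpha> m \<in> S} \<in> sets (bernoulli_measure P)" .
  moreover have "infinite_seqs \<Omega> \<in> sets (bernoulli_measure P)"
    using all[of UNIV "\<lambda>_. \<Omega>"] by (simp add: infinite_seqs_def)
  moreover have "cylinder \<Omega> S = infinite_seqs \<Omega> \<inter> {\<alpha>. \<exists>m. initial_segment \<alpha> m \<in> S}"
    by (auto simp: cylinder_def)
  ultimately show ?thesis by auto
qed

lemma measure_cylinder_singleton: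
  fixes \<Omega> :: "'a::finite_object set"
  assumes "P \<in> discrete_prob_spaces \<Omega>"
  shows "measure (bernoulli_measure P) (cylinder \<Omega> {\<sigma>}) = prod_list (map (pmf P) \<sigma>)"
proof -
  interpret product_prob_space "\<lambda>_. measure_pmf P" "UNIV :: nat set"
    by unfold_locales
  let ?M = "bernoulli_measure P"
  have sp: "space ?M = UNIV"
    by (simp add: bernoulli_measure_def space_PiM)
  define E where "E = {\<alpha>. \<forall>k<length \<sigma>. \<alpha> k = \<sigma> ! k}"
  have E_emb: "E = prod_emb UNIV (\<lambda>_. measure_pmf P) {..<length \<sigma>}
                 (\<Pi>\<^sub>E k\<in>{..<length \<sigma>}. {\<sigma> ! k})"
  proof (rule set_eqI)
    fix \<alpha> :: "nat \<Rightarrow> 'a"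
    have "\<alpha> \<in> E \<longleftrightarrow> restrict \<alpha> {..<length \<sigma>} \<in> (\<Pi>\<^sub>E k\<in>{..<length \<sigma>}. {\<sigma> ! k})"
      by (simp add: E_def restrict_PiE_iff Pi_iff Ball_def)
    then show "\<alpha> \<in> E \<longleftrightarrow> \<alpha> \<in> prod_emb UNIV (\<lambda>_. measure_pmf P) {..<length \<sigma>}
                 (\<Pi>\<^sub>E k\<in>{..<length \<sigma>}. {\<sigma> ! k})"
      by (simp add: prod_emb_iff)
  qed
  have "measure ?M E = (\<Prod>k<length \<sigma>. measure (measure_pmf P) {\<sigma> ! k})"
    unfolding E_emb bernoulli_measure_def by (rule measure_PiM_emb) simp_all
  also have "\<dots> = (\<Prod>k<length \<sigma>. pmf P (\<sigma> ! k))"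
    by (simp add: measure_pmf_single)
  also have "\<dots> = prod_list (map (pmf P) \<sigma>)"
    by (simp add: prod.list_conv_set_nth atLeast0LessThan)
  finally have ME: "measure ?M E = prod_list (map (pmf P) \<sigma>)" .
  have "AE \<alpha> in ?M. \<alpha> k \<in> \<Omega>" for k
    unfolding bernoulli_measure_def
    using assms by (intro AE_component) (auto simp: discrete_prob_spaces_def AE_measure_pmf_iff)
  then have ae: "AE \<alpha> in ?M. \<alpha> \<in> infinite_seqs \<Omega>"
    by (simp add: infinite_seqs_def AE_all_countable)
  have E_sets: "E \<in> sets ?M"
    unfolding E_emb bernoulli_measure_def by (rule sets_PiM_I) auto
  have cyl: "cylinder \<Omega> {\<sigma>} = infinite_seqs \<Omega> \<inter> E"
    by (auto simp: cylinder_def E_def initial_segment_eq_iff)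
  have "measure ?M (cylinder \<Omega> {\<sigma>}) = measure ?M E"
    using ae by (intro measure_eq_AE cylinder_in_sets E_sets) (auto simp: cyl)
  with ME show ?thesis by simp
qed

definition martin_loef_test :: "'a::finite_object set \<Rightarrow> 'a pmf \<Rightarrow> (nat \<times> 'a list) set \<Rightarrow> bool" where
  "martin_loef_test \<Omega> P C \<longleftrightarrow>
     C \<subseteq> {1..} \<times> lists \<Omega> \<and> re_set C \<and>
     (\<forall>n\<ge>1. prefix_free {\<sigma>. (n, \<sigma>) \<in> C} \<and>
            measure (bernoulli_measure P) (cylinder \<Omega> {\<sigma>. (n, \<sigma>) \<in> C}) < (1/2) ^ n)"

definition martin_loef_random :: "'a::finite_object set \<Rightarrow> 'a pmf \<Rightarrow> (nat \<Rightarrow> 'a) \<Rightarrow> bool" where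
  "martin_loef_random \<Omega> P \<alpha> \<longleftrightarrow>
     \<alpha> \<in> infinite_seqs \<Omega> \<and>
     (\<forall>C. martin_loef_test \<Omega> P C \<longrightarrow> (\<exists>n\<ge>1. \<alpha> \<notin> cylinder \<Omega> {\<sigma>. (n, \<sigma>) \<in> C}))"

definition ensemble :: "'a::finite_object set \<Rightarrow> 'a pmf \<Rightarrow> (nat \<Rightarrow> 'a) \<Rightarrow> bool" where
  "ensemble \<Omega> P \<alpha> \<longleftrightarrow> martin_loef_random \<Omega> P \<alpha>"

text \<open>
  Finite families are indexed by \<open>{1..n}\<close>; the tuple \<open>(x\<^sub>1, \<dots>, x\<^sub>n)\<close> is the list
  \<open>tuple n x\<close>, so that \<open>\<Omega>\<^sub>1 \<times> \<dots> \<times> \<Omega>\<^sub>n\<close> is again a set of finite objects.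
  That all \<open>\<Omega>\<^sub>i\<close> are subsets of one type is no restriction, as every finite object has a code in \<open>nat\<close>.
\<close>

definition tuple :: "nat \<Rightarrow> (nat \<Rightarrow> 'b) \<Rightarrow> 'b list" where
  "tuple n x = map x [1..<Suc n]"

definition product_alphabet :: "nat \<Rightarrow> (nat \<Rightarrow> 'b set) \<Rightarrow> 'b list set" where
  "product_alphabet n \<Omega> = {tuple n x |x. \<forall>i\<in>{1..n}. x i \<in> \<Omega> i}"

definition product_space :: "nat \<Rightarrow> (nat \<Rightarrow> 'b pmf) \<Rightarrow> 'b list pmf" where
  "product_space n P = map_pmf (tuple n) (Pi_pmf {1..n} undefined P)"

definition product_seq :: "nat \<Rightarrow> (nat \<Rightarrow> nat \<Rightarrow> 'b) \<Rightarrow> nat \<Rightarrow> 'b list" where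
  "product_seq n \<alpha> = (\<lambda>k. tuple n (\<lambda>i. \<alpha> i k))"

lemma pmf_product_space: "pmf (product_space n P) (tuple n a) = (\<Prod>i\<in>{1..n}. pmf (P i) (a i))"
proof -
  define b where "b = (\<lambda>i. if i \<in> {1..n} then a i else undefined)"
  let ?D = "PiE_dflt {1..n} undefined (\<lambda>_. UNIV)"
  have inj: "inj_on (tuple n) ?D"
  proof (rule inj_onI)
    fix f g assume fg: "f \<in> ?D" "g \<in> ?D" "tuple n f = tuple n g"
    then have eq: "\<forall>i\<in>{1..n}. f i = g i" by (auto simp: tuple_def)
    show "f = g"
    proof
      fix i show "f i = g i"
        using eq fg(1,2) by (cases "i \<in> {1..n}") (auto simp: PiE_dflt_def)
    qed
  qed
  have sub: "set_pmf (Pi_pmf {1..n} undefined P) \<subseteq> ?D"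
    using set_Pi_pmf_subset[of "{1..n}" undefined P] by (auto simp: PiE_dflt_def)
  have tb: "tuple n a = tuple n b" by (auto simp: tuple_def b_def)
  have bD: "b \<in> ?D" by (auto simp: b_def PiE_dflt_def)
  have "pmf (product_space n P) (tuple n b) =
      measure (Pi_pmf {1..n} undefined P) (tuple n -` {tuple n b})"
    by (simp add: product_space_def pmf_map)
  also have "\<dots> = measure (Pi_pmf {1..n} undefined P) {b}"
    using sub bD inj by (intro measure_prob_cong_0) (auto simp: set_pmf_iff inj_on_def subset_iff)
  also have "\<dots> = pmf (Pi_pmf {1..n} undefined P) b"
    by (simp add: measure_pmf_single)
  also have "\<dots> = (\<Prod>i\<in>{1..n}. pmf (P i) (b i))"
    by (subst pmf_Pi') (auto simp: b_def)
  also have "\<dots> = (\<Prod>i\<in>{1..n}. pmf (P i) (a i))"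
    by (intro prod.cong) (auto simp: b_def)
  finally show ?thesis by (simp add: tb)
qed

definition independent_rvs ::
    "nat \<Rightarrow> 'a set \<Rightarrow> 'a pmf \<Rightarrow> (nat \<Rightarrow> 'b set) \<Rightarrow> (nat \<Rightarrow> 'a \<Rightarrow> 'b) \<Rightarrow> bool" where
  "independent_rvs n \<Omega> P \<Omega>' X \<longleftrightarrow>
     (\<forall>x. (\<forall>i\<in>{1..n}. x i \<in> \<Omega>' i) \<longrightarrow>
        measure_pmf.prob P {a \<in> \<Omega>. \<forall>i\<in>{1..n}. X i a = x i} =
        (\<Prod>i\<in>{1..n}. measure_pmf.prob P {a \<in> \<Omega>. X i a = x i}))"

text \<open>Independence of ensembles presupposes that each \<open>\<alpha> i\<close> is an ensemble for \<open>P i\<close>.\<close>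

definition independent_ensembles ::
    "nat \<Rightarrow> (nat \<Rightarrow> 'b::finite_object set) \<Rightarrow> (nat \<Rightarrow> 'b pmf) \<Rightarrow> (nat \<Rightarrow> nat \<Rightarrow> 'b) \<Rightarrow> bool" where
  "independent_ensembles n \<Omega> P \<alpha> \<longleftrightarrow>
     (\<forall>i\<in>{1..n}. ensemble (\<Omega> i) (P i) (\<alpha> i)) \<and>
     ensemble (product_alphabet n \<Omega>) (product_space n P) (product_seq n \<alpha>)"

end

theory Submission
  imports Defs
begin

text \<open>
  Write \<open>Y\<close> for the map \<open>a \<mapsto> (X 1 a, \<dots>, X n a)\<close>. Its distribution \<open>map_pmf Y P\<close> is the joint law of
  the random variables, and they are independent precisely when this joint law equals the
  product of the marginal laws (\<open>independent_rvs_iff_product_space\<close>). For an ensemble \<open>\<alpha>\<close>, the sequence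
  \<open>Y \<circ> \<alpha>\<close> is the product of the sequences \<open>X i \<circ> \<alpha>\<close>, so independence of these ensembles means that
  \<open>Y \<circ> \<alpha>\<close> is random for the product of the marginals. Two facts connect the two notions.

  First, randomness is preserved under recursive maps of the alphabet
  (\<open>martin_loef_random_map\<close>): a test for the image pulls back to a test for \<open>\<alpha>\<close>. Hence
  \<open>Y \<circ> \<alpha>\<close> is always random for the joint law, and each \<open>X i \<circ> \<alpha>\<close> for its marginal law.

  Secondly, a sequence is random for at most one distribution
  (\<open>martin_loef_random_pmf_unique\<close>), because an effective law of large numbers makes the distribution
  visible as limiting frequencies. Its test is the set of strings that stop when the average of a 0-1
  sequence first exceeds a rational threshold after a given time; Hoeffding's inequality
  bounds its measure. The threshold is a rational strictly between the two probabilities to be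
  separated and is built into the test as a constant, which yields a test for an arbitrary distribution.

  Consequently, for any single ensemble \<open>\<alpha>\<close>, the ensembles \<open>X i \<circ> \<alpha>\<close> are independent if and only
  if the joint law is the product law. The right-hand side does not mention \<open>\<alpha>\<close>, so "for all" and
  "for some" \<open>\<alpha>\<close> agree once an ensemble exists (\<open>ex_martin_loef_random\<close>).

  The recursion-theoretic part shows that the pulled back test, the first-crossing test and the
  product alphabet are recursively enumerable. For this, the \<open>\<mu>\<close>-recursive functions are equipped
  with closure rules for arithmetic, for pairing, and for lists coded as numbers.
\<close>

section \<open>Computable functions of several arguments\<close>

instance recf :: countable
  by countable_datatype

text \<open>
  Only argument lists of length \<open>k\<close> are constrained, since a code denotes a function of every arity.
  Values are optional so that the domain of a composition of partial functions comes out right: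
  the sets below are recursively enumerable as domains of such compositions.
\<close>

definition computable :: "nat \<Rightarrow> (nat list \<Rightarrow> nat option) \<Rightarrow> bool" where
  "computable k F \<longleftrightarrow> (\<exists>c. \<forall>xs. length xs = k \<longrightarrow> eval_recf c xs = F xs)"

abbreviation total_computable :: "nat \<Rightarrow> (nat list \<Rightarrow> nat) \<Rightarrow> bool" where
  "total_computable k f \<equiv> computable k (\<lambda>xs. Some (f xs))"

lemma computable_cong:
  assumes "computable k F" and "\<And>xs. length xs = k \<Longrightarrow> F xs = G xs"
  shows "computable k G"
  using assms by (auto simp: computable_def)

lemma partial_recursive_iff_computable:
  "partial_recursive f \<longleftrightarrow> computable 1 (\<lambda>xs. f (xs ! 0))"
proof -
  have "(\<forall>x. f x = eval_recf c [x]) \<longleftrightarrow>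
      (\<forall>xs. length xs = 1 \<longrightarrow> eval_recf c xs = f (xs ! 0))" for c
    by (auto simp: length_Suc_conv)
  then show ?thesis by (simp add: partial_recursive_def computable_def)
qed

lemma computable_proj: "i < k \<Longrightarrow> total_computable k (\<lambda>xs. xs ! i)"
  unfolding computable_def by (rule exI[of _ "Proj i"]) simp

lemma computable_compose:
  assumes "computable (length fs) G" and "\<And>f. f \<in> set fs \<Longrightarrow> total_computable k f"
  shows "computable k (\<lambda>xs. G (map (\<lambda>f. f xs) fs))"
proof -
  obtain c where c: "\<And>xs. length xs = length fs \<Longrightarrow> eval_recf c xs = G xs"
    using assms(1) by (auto simp: computable_def)
  obtain d where d: "\<And>f xs. f \<in> set fs \<Longrightarrow> length xs = k \<Longrightarrow> eval_recf (d f) xs = Some (f xs)"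
    using assms(2) unfolding computable_def by metis
  have "eval_recf (Comp c (map d fs)) xs = G (map (\<lambda>f. f xs) fs)" if "length xs = k" for xs
  proof -
    have "map (\<lambda>g. the (eval_recf g xs)) (map d fs) = map (\<lambda>f. f xs) fs"
      using d that by simp
    then show ?thesis using d that c[of "map (\<lambda>f. f xs) fs"] by (simp del: map_map)
  qed
  then show ?thesis unfolding computable_def by blast
qed

text \<open>
  The value of \<open>F\<close> is pushed in front of the arguments, so a computation in several partial steps
  becomes a nesting of binds, each step seeing all earlier results.
\<close>

lemma computable_bind:
  assumes "computable k F" and "computable (Suc k) G"
  shows "computable k (\<lambda>xs. Option.bind (F xs) (\<lambda>a. G (a # xs)))"
proof -
  obtain c where c: "\<And>xs. length xs = k \<Longrightarrow> eval_recf c xs = F xs"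
    using assms(1) by (auto simp: computable_def)
  obtain d where d: "\<And>xs. length xs = Suc k \<Longrightarrow> eval_recf d xs = G xs"
    using assms(2) by (auto simp: computable_def)
  have "eval_recf (Comp d (c # map Proj [0..<k])) xs = Option.bind (F xs) (\<lambda>a. G (a # xs))"
    if l: "length xs = k" for xs
  proof -
    have m: "map (\<lambda>g. the (eval_recf g xs)) (map Proj [0..<k]) = xs"
      using l by (auto intro!: nth_equalityI)
    have "eval_recf g xs \<noteq> None" if "g \<in> set (map Proj [0..<k])" for g
      using that l by auto
    then have "eval_recf (Comp d (c # map Proj [0..<k])) xs =
        (if F xs \<noteq> None then eval_recf d (the (F xs) # xs) else None)"
      using c[OF l] m by auto
    then show ?thesis using d l by (cases "F xs") auto
  qed
  then show ?thesis unfolding computable_def by blast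
qed

lemma computable_prim_rec:
  assumes "computable k F" and "computable (Suc (Suc k)) G"
  shows "computable (Suc k)
    (\<lambda>xs. rec_nat (F (tl xs)) (\<lambda>m r. Option.bind r (\<lambda>v. G (m # v # tl xs))) (hd xs))"
proof -
  obtain c where c: "\<And>xs. length xs = k \<Longrightarrow> eval_recf c xs = F xs"
    using assms(1) by (auto simp: computable_def)
  obtain d where d: "\<And>xs. length xs = Suc (Suc k) \<Longrightarrow> eval_recf d xs = G xs"
    using assms(2) by (auto simp: computable_def)
  have "eval_recf (PrimRec c d) xs =
      rec_nat (F (tl xs)) (\<lambda>m r. Option.bind r (\<lambda>v. G (m # v # tl xs))) (hd xs)"
    if "length xs = Suc k" for xs
  proof -
    from that obtain n ys where xs: "xs = n # ys" "length ys = k" by (auto simp: length_Suc_conv)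
    show ?thesis unfolding xs(1) using xs(2)
      by (simp add: c d)
  qed
  then show ?thesis unfolding computable_def by blast
qed

lemma total_computable_prim_rec:
  assumes "total_computable k f" and "total_computable (Suc (Suc k)) g"
    and "\<And>ys. length ys = k \<Longrightarrow> h 0 ys = f ys"
    and "\<And>m ys. length ys = k \<Longrightarrow> h (Suc m) ys = g (m # h m ys # ys)"
  shows "total_computable (Suc k) (\<lambda>xs. h (hd xs) (tl xs))"
proof (rule computable_cong[OF computable_prim_rec[OF assms(1,2)]])
  fix xs :: "nat list" assume "length xs = Suc k"
  then have l: "length (tl xs) = k" by simp
  have "rec_nat (Some (f (tl xs))) (\<lambda>m r. Option.bind r (\<lambda>v. Some (g (m # v # tl xs)))) n =
      Some (h n (tl xs))" for n
    by (induction n) (use assms(3,4) l in auto)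
  then show "rec_nat (Some (f (tl xs))) (\<lambda>m r. Option.bind r (\<lambda>v. Some (g (m # v # tl xs)))) (hd xs) =
      Some (h (hd xs) (tl xs))" .
qed

lemma computable_search:
  assumes "total_computable (Suc k) g"
  shows "computable k (\<lambda>xs. if \<exists>z. g (z # xs) = 0 then Some (LEAST z. g (z # xs) = 0) else None)"
proof -
  obtain c where c: "\<And>xs. length xs = Suc k \<Longrightarrow> eval_recf c xs = Some (g xs)"
    using assms by (auto simp: computable_def)
  have "eval_recf (Mu c) xs = (if \<exists>z. g (z # xs) = 0 then Some (LEAST z. g (z # xs) = 0) else None)"
    if "length xs = k" for xs
    using that by (simp add: c)
  then show ?thesis unfolding computable_def by blast
qed

lemma total_computable_search:
  assumes "total_computable (Suc k) g" and "\<And>xs. length xs = k \<Longrightarrow> \<exists>z. g (z # xs) = 0"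
  shows "total_computable k (\<lambda>xs. LEAST z. g (z # xs) = 0)"
proof (rule computable_cong[OF computable_search[OF assms(1)]])
  show "(if \<exists>z. g (z # xs) = 0 then Some (LEAST z. g (z # xs) = 0) else None) =
      Some (LEAST z. g (z # xs) = 0)" if "length xs = k" for xs
    using assms(2)[OF that] by (rule if_P)
qed

text \<open>
  Searching for a zero of a function that ignores the search variable halts at once or never.
  This turns a decidable condition into a restriction of the domain.
\<close>

lemma computable_guard:
  assumes "total_computable k c"
  shows "computable k (\<lambda>xs. if c xs = 0 then Some 0 else None)"
proof -
  have "total_computable (Suc k) (\<lambda>xs. c (tl xs))"
  proof (rule computable_cong)
    let ?fs = "map (\<lambda>i xs. xs ! Suc i) [0..<k]"
    show "total_computable (Suc k) (\<lambda>xs. c (map (\<lambda>f. f xs) ?fs))"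
      by (rule computable_compose) (auto simp: assms intro: computable_proj)
    show "Some (c (map (\<lambda>f. f xs) ?fs)) = Some (c (tl xs))" if "length xs = Suc k" for xs
      using that by (auto simp: nth_tl intro!: arg_cong[of _ _ c] nth_equalityI)
  qed
  from computable_search[OF this] show ?thesis by (simp cong: if_cong)
qed

text \<open>
  The lifting rules have conclusions of the form \<open>\<lambda>xs. h (f xs)\<close> for a fixed \<open>h\<close>. Together with
  projections and constants they let computability be read off from the shape of a term.
\<close>

lemma total_computable_lift1:
  assumes "total_computable 1 (\<lambda>xs. h (xs ! 0))" and "total_computable k f"
  shows "total_computable k (\<lambda>xs. h (f xs))"
  using computable_compose[of "[f]" "\<lambda>xs. Some (h (xs ! 0))" k] assms by simp

lemma total_computable_lift2:
  assumes "total_computable 2 (\<lambda>xs. h (xs ! 0) (xs ! 1))"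
    and "total_computable k f" and "total_computable k g"
  shows "total_computable k (\<lambda>xs. h (f xs) (g xs))"
  using computable_compose[of "[f, g]" "\<lambda>xs. Some (h (xs ! 0) (xs ! 1))" k] assms
  by (auto simp: numeral_2_eq_2)

lemma computable_apply:
  assumes "computable 1 (\<lambda>xs. F (xs ! 0))" and "total_computable k f"
  shows "computable k (\<lambda>xs. F (f xs))"
  using computable_compose[of "[f]" "\<lambda>xs. F (xs ! 0)" k] assms by simp

lemma total_computable_zero: "total_computable k (\<lambda>xs. 0)"
  unfolding computable_def by (rule exI[of _ Zero]) simp

lemma total_computable_Suc: "total_computable k f \<Longrightarrow> total_computable k (\<lambda>xs. Suc (f xs))"
proof (rule total_computable_lift1[where h = Suc])
  show "total_computable 1 (\<lambda>xs. Suc (xs ! 0))"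
    unfolding computable_def by (rule exI[of _ Succ]) (auto simp: length_Suc_conv)
qed

lemma total_computable_const: "total_computable k (\<lambda>xs. c)"
  by (induction c) (auto intro: total_computable_zero total_computable_Suc)

lemma total_computable_prim_rec_unary:
  assumes "total_computable 2 (\<lambda>xs. g (xs ! 0) (xs ! 1))"
    and "\<And>m. h (Suc m) = g m (h m)"
  shows "total_computable k f \<Longrightarrow> total_computable k (\<lambda>xs. h (f xs))"
proof (rule total_computable_lift1[where h = h])
  have "total_computable (Suc 0) (\<lambda>xs. h (hd xs))"
  proof (rule total_computable_prim_rec[where h = "\<lambda>m _. h m"])
    show "total_computable 0 (\<lambda>xs. h 0)" by (rule total_computable_const)
    show "total_computable (Suc (Suc 0)) (\<lambda>xs. g (xs ! 0) (xs ! 1))"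
      using assms(1) by (simp add: numeral_2_eq_2)
  qed (use assms(2) in auto)
  then show "total_computable 1 (\<lambda>xs. h (xs ! 0))"
    unfolding One_nat_def by (rule computable_cong) (auto simp: length_Suc_conv)
qed

lemma total_computable_prim_rec_binary:
  assumes "total_computable 1 (\<lambda>xs. b (xs ! 0))"
    and "total_computable 3 (\<lambda>xs. g (xs ! 0) (xs ! 1) (xs ! 2))"
    and "\<And>y. h 0 y = b y" and "\<And>m y. h (Suc m) y = g m (h m y) y"
  shows "total_computable k f \<Longrightarrow> total_computable k f' \<Longrightarrow> total_computable k (\<lambda>xs. h (f xs) (f' xs))"
proof (rule total_computable_lift2[where h = h])
  have "total_computable (Suc 1) (\<lambda>xs. h (hd xs) (tl xs ! 0))"
  proof (rule total_computable_prim_rec[where h = "\<lambda>m ys. h m (ys ! 0)"])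
    show "total_computable 1 (\<lambda>xs. b (xs ! 0))" by (rule assms(1))
    show "total_computable (Suc (Suc 1)) (\<lambda>xs. g (xs ! 0) (xs ! 1) (xs ! 2))"
      using assms(2) by (simp add: numeral_3_eq_3)
  qed (use assms(3,4) in auto)
  then show "total_computable 2 (\<lambda>xs. h (xs ! 0) (xs ! 1))"
    unfolding numeral_2_eq_2 One_nat_def[symmetric]
    by (rule computable_cong) (auto simp: length_Suc_conv)
qed

lemma total_computable_add:
  "total_computable k f \<Longrightarrow> total_computable k g \<Longrightarrow> total_computable k (\<lambda>xs. f xs + g xs)"
  by (rule total_computable_prim_rec_binary[where b = "\<lambda>y. y" and g = "\<lambda>m v y. Suc v"])
    (auto intro!: total_computable_Suc computable_proj)

lemma total_computable_mult:
  "total_computable k f \<Longrightarrow> total_computable k g \<Longrightarrow> total_computable k (\<lambda>xs. f xs * g xs)"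
  by (rule total_computable_prim_rec_binary[where b = "\<lambda>y. 0" and g = "\<lambda>m v y. y + v"])
    (auto intro!: total_computable_const total_computable_add computable_proj)

lemma total_computable_pred: "total_computable k f \<Longrightarrow> total_computable k (\<lambda>xs. f xs - 1)"
  by (rule total_computable_prim_rec_unary[where g = "\<lambda>m v. m"]) (auto intro!: computable_proj)

lemma total_computable_diff:
  assumes "total_computable k f" and "total_computable k g"
  shows "total_computable k (\<lambda>xs. f xs - g xs)"
proof -
  have "total_computable k (\<lambda>xs. (\<lambda>m y. y - m) (g xs) (f xs))"
    by (rule total_computable_prim_rec_binary[where b = "\<lambda>y. y" and g = "\<lambda>m v y. v - 1"])
      (auto intro!: total_computable_pred[simplified] computable_proj assms)
  then show ?thesis by simp
qed

lemma total_computable_triangle: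
  "total_computable k f \<Longrightarrow> total_computable k (\<lambda>xs. triangle (f xs))"
  by (rule total_computable_prim_rec_unary[where g = "\<lambda>m v. v + Suc m"])
    (auto intro!: total_computable_add total_computable_Suc computable_proj)

lemmas total_computable_intros =
  computable_proj total_computable_const total_computable_Suc total_computable_add
  total_computable_mult total_computable_pred total_computable_diff total_computable_triangle

lemma total_computable_prod_encode:
  "total_computable k f \<Longrightarrow> total_computable k g \<Longrightarrow>
    total_computable k (\<lambda>xs. prod_encode (f xs, g xs))"
  unfolding prod_encode_def by (auto intro!: total_computable_intros)

text \<open>
  The pairing function enumerates the pairs \<open>(a, b)\<close> along the diagonals \<open>a + b = w\<close>, and
  \<open>triangle w\<close> pairs precede diagonal \<open>w\<close>. Unpairing therefore reduces to searching for the diagonal.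
\<close>

definition diagonal :: "nat \<Rightarrow> nat" where
  "diagonal p = (LEAST w. Suc p - triangle (Suc w) = 0)"

lemma diagonal_prod_encode: "diagonal (prod_encode (a, b)) = a + b"
  unfolding diagonal_def
proof (rule Least_equality)
  show "Suc (prod_encode (a, b)) - triangle (Suc (a + b)) = 0"
    by (simp add: prod_encode_def)
  have mono: "triangle m \<le> triangle m'" if "m \<le> m'" for m m'
    using that by (induction rule: dec_induct) auto
  show "a + b \<le> w" if "Suc (prod_encode (a, b)) - triangle (Suc w) = 0" for w
    using that mono[of "Suc w" "a + b"] by (cases "a + b \<le> w") (auto simp: prod_encode_def)
qed

lemma total_computable_diagonal:
  "total_computable k f \<Longrightarrow> total_computable k (\<lambda>xs. diagonal (f xs))"
proof (rule total_computable_lift1[where h = diagonal])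
  have "total_computable 1 (\<lambda>xs. LEAST w. (\<lambda>ys. Suc (ys ! 1) - triangle (Suc (ys ! 0))) (w # xs) = 0)"
  proof (rule total_computable_search)
    show "total_computable (Suc 1) (\<lambda>ys. Suc (ys ! 1) - triangle (Suc (ys ! 0)))"
      by (intro total_computable_intros) auto
    show "\<exists>z. Suc ((z # xs) ! 1) - triangle (Suc ((z # xs) ! 0)) = 0" for xs :: "nat list"
      by (rule exI[of _ "xs ! 0"]) simp
  qed
  then show "total_computable 1 (\<lambda>xs. diagonal (xs ! 0))" by (simp add: diagonal_def)
qed

lemma total_computable_fst_prod_decode:
  assumes "total_computable k f"
  shows "total_computable k (\<lambda>xs. fst (prod_decode (f xs)))"
proof -
  have "fst (prod_decode p) = p - triangle (diagonal p)" for p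
  proof -
    obtain a b where p: "p = prod_encode (a, b)"
      using prod_decode_inverse[of p] by (metis prod.exhaust)
    have "prod_encode (a, b) - triangle (a + b) = a" by (simp add: prod_encode_def)
    then show ?thesis unfolding p diagonal_prod_encode by simp
  qed
  then show ?thesis using assms by (auto intro!: total_computable_intros total_computable_diagonal)
qed

lemma total_computable_snd_prod_decode:
  assumes "total_computable k f"
  shows "total_computable k (\<lambda>xs. snd (prod_decode (f xs)))"
proof -
  have "snd (prod_decode p) = diagonal p - fst (prod_decode p)" for p
  proof -
    obtain a b where p: "p = prod_encode (a, b)"
      using prod_decode_inverse[of p] by (metis prod.exhaust)
    show ?thesis unfolding p diagonal_prod_encode by simp
  qed
  then show ?thesis using assms
    by (auto intro!: total_computable_intros total_computable_diagonal total_computable_fst_prod_decode)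
qed

section \<open>Coded lists\<close>

definition cons_code :: "nat \<Rightarrow> nat \<Rightarrow> nat" where "cons_code x s = Suc (prod_encode (x, s))"
definition hd_code :: "nat \<Rightarrow> nat" where "hd_code s = fst (prod_decode (s - 1))"
definition tl_code :: "nat \<Rightarrow> nat" where "tl_code s = snd (prod_decode (s - 1))"
definition drop_code :: "nat \<Rightarrow> nat \<Rightarrow> nat" where "drop_code k s = (tl_code ^^ k) s"
definition length_code :: "nat \<Rightarrow> nat" where "length_code s = (LEAST k. drop_code k s = 0)"

text \<open>
  Because of this value the code \<open>0\<close> of the empty list has tail \<open>0\<close>. Hence \<open>drop_code\<close> is
  meaningful beyond the end of a list, and the length of a list is the first \<open>k\<close> with \<open>drop_code k s = 0\<close>.
\<close>

lemma prod_decode_0: "prod_decode 0 = (0, 0)"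
  using prod_encode_inverse[of "(0, 0)"] by (simp add: prod_encode_def)

lemma cons_code_list_encode: "cons_code x (list_encode xs) = list_encode (x # xs)"
  by (simp add: cons_code_def)

lemma hd_code_list_encode: "hd_code (list_encode (x # xs)) = x"
  by (simp add: hd_code_def)

lemma tl_code_list_encode: "tl_code (list_encode xs) = list_encode (tl xs)"
  by (cases xs) (auto simp: tl_code_def prod_decode_0)

lemma drop_code_list_encode: "drop_code k (list_encode xs) = list_encode (drop k xs)"
  by (induction k) (auto simp: drop_code_def tl_code_list_encode drop_Suc tl_drop)

lemma hd_drop_code_list_encode:
  "i < length xs \<Longrightarrow> hd_code (drop_code i (list_encode xs)) = xs ! i"
  by (simp add: drop_code_list_encode Cons_nth_drop_Suc[symmetric] hd_code_list_encode del: list_encode.simps)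

lemma list_encode_eq_0_iff: "list_encode xs = 0 \<longleftrightarrow> xs = []"
  by (cases xs) auto

lemma length_code_list_encode: "length_code (list_encode xs) = length xs"
  unfolding length_code_def by (rule Least_equality) (auto simp: drop_code_list_encode list_encode_eq_0_iff)

lemma total_computable_cons_code:
  "total_computable k f \<Longrightarrow> total_computable k g \<Longrightarrow> total_computable k (\<lambda>xs. cons_code (f xs) (g xs))"
  unfolding cons_code_def by (intro total_computable_intros total_computable_prod_encode)

lemma total_computable_hd_code: "total_computable k f \<Longrightarrow> total_computable k (\<lambda>xs. hd_code (f xs))"
  unfolding hd_code_def by (intro total_computable_intros total_computable_fst_prod_decode)

lemma total_computable_tl_code: "total_computable k f \<Longrightarrow> total_computable k (\<lambda>xs. tl_code (f xs))"
  unfolding tl_code_def by (intro total_computable_intros total_computable_snd_prod_decode)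

lemma total_computable_drop_code:
  "total_computable k f \<Longrightarrow> total_computable k g \<Longrightarrow> total_computable k (\<lambda>xs. drop_code (f xs) (g xs))"
  by (rule total_computable_prim_rec_binary[where b = "\<lambda>y. y" and g = "\<lambda>m v y. tl_code v"])
    (auto simp: drop_code_def intro!: total_computable_tl_code computable_proj)

lemma total_computable_length_code:
  "total_computable k f \<Longrightarrow> total_computable k (\<lambda>xs. length_code (f xs))"
proof (rule total_computable_lift1[where h = length_code])
  have "total_computable 1 (\<lambda>xs. LEAST w. (\<lambda>ys. drop_code (ys ! 0) (ys ! 1)) (w # xs) = 0)"
  proof (rule total_computable_search)
    show "total_computable (Suc 1) (\<lambda>ys. drop_code (ys ! 0) (ys ! 1))"
      by (intro total_computable_drop_code computable_proj) auto
    have "drop_code (length (list_decode s)) s = 0" for s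
      using drop_code_list_encode[of "length (list_decode s)" "list_decode s"] by simp
    then show "\<exists>z. drop_code ((z # xs) ! 0) ((z # xs) ! 1) = 0" for xs :: "nat list"
      by auto
  qed
  then show "total_computable 1 (\<lambda>xs. length_code (xs ! 0))" by (simp add: length_code_def)
qed

lemmas code_intros = total_computable_cons_code total_computable_hd_code total_computable_tl_code
  total_computable_drop_code total_computable_length_code total_computable_prod_encode
  total_computable_fst_prod_decode total_computable_snd_prod_decode

lemma those_map: "those (map f xs) = (if set xs \<subseteq> dom f then Some (map (\<lambda>x. the (f x)) xs) else None)"
  by (induction xs) (auto split: option.splits)

text \<open>
  Finitely many partial functions evaluated in parallel: the coded tuple of their values is defined
  when all of them are. This serves both for the joint function of several random variables and for
  checking the entries of a tuple one by one.
\<close>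

lemma computable_those:
  assumes "\<And>F. F \<in> set Fs \<Longrightarrow> computable k F"
  shows "computable k (\<lambda>xs. map_option list_encode (those (map (\<lambda>F. F xs) Fs)))"
  using assms
proof (induction Fs)
  case Nil
  show ?case using total_computable_const[of k 0] by simp
next
  case (Cons F Fs)
  let ?R = "\<lambda>xs. map_option list_encode (those (map (\<lambda>F. F xs) Fs))"
  have R: "computable k ?R" using Cons by simp
  have "computable k (\<lambda>xs. Option.bind (?R xs) (\<lambda>r. (\<lambda>ys. Option.bind (F (tl ys))
      (\<lambda>y. (\<lambda>zs. Some (cons_code (zs ! 0) (zs ! 1))) (y # ys))) (r # xs)))"
  proof (intro computable_bind R)
    show "computable (Suc k) (\<lambda>ys. F (tl ys))"
    proof (rule computable_cong)
      let ?fs = "map (\<lambda>i xs. xs ! Suc i) [0..<k]"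
      show "computable (Suc k) (\<lambda>xs. F (map (\<lambda>f. f xs) ?fs))"
        by (rule computable_compose) (auto simp: Cons.prems intro: computable_proj)
      show "F (map (\<lambda>f. f xs) ?fs) = F (tl xs)" if "length xs = Suc k" for xs
        using that by (auto simp: nth_tl intro!: arg_cong[of _ _ F] nth_equalityI)
    qed
    show "total_computable (Suc (Suc k)) (\<lambda>zs. cons_code (zs ! 0) (zs ! 1))"
      by (intro code_intros computable_proj) auto
  qed
  then show ?case
  proof (rule computable_cong)
    fix xs :: "nat list" assume "length xs = k"
    show "Option.bind (?R xs) (\<lambda>r. (\<lambda>ys. Option.bind (F (tl ys))
        (\<lambda>y. (\<lambda>zs. Some (cons_code (zs ! 0) (zs ! 1))) (y # ys))) (r # xs)) =
        map_option list_encode (those (map (\<lambda>F. F xs) (F # Fs)))"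
      by (cases "F xs"; cases "those (map (\<lambda>F. F xs) Fs)")
        (simp_all add: cons_code_list_encode del: list_encode.simps)
  qed
qed

definition sum_code :: "nat \<Rightarrow> nat \<Rightarrow> nat" where
  "sum_code k s = (\<Sum>i<k. hd_code (drop_code i s))"

lemma total_computable_sum_code:
  "total_computable k f \<Longrightarrow> total_computable k g \<Longrightarrow> total_computable k (\<lambda>xs. sum_code (f xs) (g xs))"
proof (rule total_computable_prim_rec_binary[where h = sum_code and b = "\<lambda>y. 0" and g = "\<lambda>m v y. v + hd_code (drop_code m y)"])
  show "total_computable 3 (\<lambda>xs. xs ! 1 + hd_code (drop_code (xs ! 0) (xs ! 2)))"
    by (intro total_computable_intros code_intros) auto
qed (auto simp: sum_code_def intro: total_computable_const)

lemma sum_code_list_encode: "k \<le> length xs \<Longrightarrow> sum_code k (list_encode xs) = (\<Sum>i<k. xs ! i)"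
  by (simp add: sum_code_def hd_drop_code_list_encode)

text \<open>
  A partial function is applied to all entries of a coded list by primitive recursion from the back:
  after \<open>k\<close> steps the accumulator codes the image of the last \<open>k\<close> entries, so that consing on the
  next image keeps the order.
\<close>

lemma computable_map_code:
  assumes f: "computable 1 (\<lambda>xs. f (xs ! 0))"
  shows "computable 1 (\<lambda>xs. map_option list_encode (those (map f (list_decode (xs ! 0)))))"
proof -
  define el where "el m s = hd_code (drop_code (length_code s - 1 - m) s)" for m s
  define step where "step xs = Option.bind (f (el (xs ! 0) (xs ! 2)))
      (\<lambda>y. (\<lambda>ys. Some (cons_code (ys ! 0) (ys ! 2))) (y # xs))" for xs :: "nat list"
  define R where "R k s = rec_nat (Some 0) (\<lambda>m r. Option.bind r (\<lambda>v. step (m # v # [s]))) k" for k s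
  have "computable (Suc (Suc 1)) step"
    unfolding step_def
  proof (rule computable_bind)
    show "computable (Suc (Suc 1)) (\<lambda>xs. f (el (xs ! 0) (xs ! 2)))"
      unfolding el_def
      by (rule computable_apply[OF f], intro total_computable_intros code_intros) auto
    show "total_computable (Suc (Suc (Suc 1))) (\<lambda>ys. cons_code (ys ! 0) (ys ! 2))"
      by (intro code_intros computable_proj) auto
  qed
  from computable_prim_rec[OF total_computable_const this, of 0]
  have "computable 2 (\<lambda>xs. R (xs ! 0) (xs ! 1))"
    unfolding numeral_2_eq_2 One_nat_def[symmetric]
    by (rule computable_cong) (auto simp: R_def length_Suc_conv)
  then have "computable 1 (\<lambda>xs. R (length_code (xs ! 0)) (xs ! 0))"
    using computable_compose[of "[\<lambda>xs. length_code (xs ! 0), \<lambda>xs. xs ! 0]" "\<lambda>xs. R (xs ! 0) (xs ! 1)" 1]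
      total_computable_length_code[OF computable_proj, of 0 1] computable_proj[of 0 1]
    by (auto simp: numeral_2_eq_2)
  moreover have "R (length_code s) s = map_option list_encode (those (map f (list_decode s)))" for s
  proof -
    define l where "l = list_decode s"
    have s: "s = list_encode l" by (simp add: l_def)
    have "R k s = map_option list_encode (those (map f (drop (length l - k) l)))" if "k \<le> length l" for k
      using that
    proof (induction k)
      case 0
      then show ?case by (simp add: R_def)
    next
      case (Suc k)
      let ?i = "length l - Suc k"
      have i: "?i < length l" "Suc ?i = length l - k" using Suc.prems by auto
      have el: "el k s = l ! ?i"
        using i by (simp add: el_def s length_code_list_encode hd_drop_code_list_encode)
      have "R (Suc k) s = Option.bind (R k s) (\<lambda>v. step [k, v, s])" by (simp add: R_def)
      also have "\<dots> = Option.bind (map_option list_encode (those (map f (drop (length l - k) l)))) (\<lambda>v. step [k, v, s])"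
        using Suc by simp
      also have "\<dots> = map_option list_encode (those (map f (l ! ?i # drop (length l - k) l)))"
        by (cases "f (l ! ?i)"; cases "those (map f (drop (length l - k) l))")
          (simp_all add: step_def el cons_code_list_encode del: list_encode.simps)
      also have "l ! ?i # drop (length l - k) l = drop ?i l"
        using Cons_nth_drop_Suc[OF i(1)] i(2) by simp
      finally show ?case .
    qed
    from this[of "length l"] show ?thesis by (simp add: s length_code_list_encode)
  qed
  ultimately show ?thesis by simp
qed

section \<open>Recursively enumerable sets of strings and tuples\<close>

lemma encode_pair: "encode (x, y) = prod_encode (encode x, encode y)"
  by (simp add: encode_prod_def)

lemma encode_nat_list: "encode (xs :: nat list) = list_encode xs"
proof -
  have "map encode xs = xs" by (simp add: encode_nat_def map_idI)
  then show ?thesis by (simp add: encode_list_def)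
qed

lemma encode_eq_iff: "encode x = encode y \<longleftrightarrow> x = y"
  using inj_encode by (auto dest: injD)

text \<open>
  Semi-decision: translate the string entry by entry, which converges only on strings over \<open>\<Omega>\<close>
  because \<open>\<Omega>\<close> is the domain of the code for \<open>Y\<close>, and then wait for the translated pair to enter \<open>D\<close>.
\<close>

lemma re_set_preimage_map:
  fixes Y :: "'a::finite_object \<Rightarrow> 'b::finite_object" and D :: "(nat \<times> 'b list) set"
  assumes Y: "partial_recursive_on \<Omega> Y" and D: "re_set D"
  shows "re_set {(n, \<sigma>). \<sigma> \<in> lists \<Omega> \<and> (n, map Y \<sigma>) \<in> D}"
proof -
  obtain f where f: "computable 1 (\<lambda>xs. f (xs ! 0))" and df: "dom f = encode ` \<Omega>"
    and fY: "\<And>a. a \<in> \<Omega> \<Longrightarrow> f (encode a) = Some (encode (Y a))"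
    using Y by (auto simp: partial_recursive_on_def partial_recursive_iff_computable)
  obtain g where g: "computable 1 (\<lambda>xs. g (xs ! 0))" and dg: "dom g = encode ` D"
    using D by (auto simp: re_set_def partial_recursive_iff_computable)
  define M where "M s = map_option list_encode (those (map f (list_decode s)))" for s
  define h where "h p = Option.bind (M (snd (prod_decode p))) (\<lambda>t. g (prod_encode (fst (prod_decode p), t)))" for p
  have M: "computable 1 (\<lambda>xs. M (xs ! 0))"
    unfolding M_def by (rule computable_map_code[OF f])
  have "computable 1 (\<lambda>xs. Option.bind (M (snd (prod_decode (xs ! 0))))
      (\<lambda>t. (\<lambda>ys. g (prod_encode (fst (prod_decode (ys ! 1)), ys ! 0))) (t # xs)))"
    by (intro computable_bind computable_apply[OF M] computable_apply[OF g] code_intros computable_proj) auto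
  then have "partial_recursive h"
    by (simp add: partial_recursive_iff_computable h_def)
  moreover have "dom h = encode ` {(n, \<sigma>). \<sigma> \<in> lists \<Omega> \<and> (n, map Y \<sigma>) \<in> D}"
  proof -
    have M_in: "M (encode \<sigma>) = Some (encode (map Y \<sigma>))" if "\<sigma> \<in> lists \<Omega>" for \<sigma>
      using that df fY by (auto simp: M_def encode_list_def those_map intro!: arg_cong[of _ _ list_encode])
    have M_out: "\<exists>\<sigma>\<in>lists \<Omega>. s = encode \<sigma>" if "M s \<noteq> None" for s
    proof -
      have "set (list_decode s) \<subseteq> encode ` \<Omega>"
        using that by (auto simp: M_def those_map df split: if_splits)
      then have "list_decode s \<in> map encode ` lists \<Omega>"
        by (simp add: lists_image[symmetric] in_lists_conv_set subset_iff)
      then obtain \<sigma> where "\<sigma> \<in> lists \<Omega>" "list_decode s = map encode \<sigma>" by auto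
      then show ?thesis by (metis encode_list_def list_decode_inverse)
    qed
    have h: "h (encode (n, \<sigma>)) \<noteq> None \<longleftrightarrow> (n, map Y \<sigma>) \<in> D" if "\<sigma> \<in> lists \<Omega>" for n :: nat and \<sigma>
    proof -
      have "h (encode (n, \<sigma>)) = g (encode (n, map Y \<sigma>))"
        by (simp add: h_def encode_pair M_in[OF that])
      then show ?thesis using dg by (metis domIff encode_eq_iff image_iff)
    qed
    show ?thesis
    proof (intro set_eqI iffI)
      fix p assume "p \<in> dom h"
      then have hp: "h p \<noteq> None" by auto
      then have "M (snd (prod_decode p)) \<noteq> None" by (cases "M (snd (prod_decode p))") (simp_all add: h_def)
      then obtain \<sigma> where \<sigma>: "\<sigma> \<in> lists \<Omega>" "snd (prod_decode p) = encode \<sigma>" using M_out by blast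
      have p: "p = encode (fst (prod_decode p), \<sigma>)"
        unfolding encode_pair encode_nat_def \<sigma>(2)[symmetric] by simp
      from h[OF \<sigma>(1), of "fst (prod_decode p)"] hp p[symmetric] show "p \<in> encode ` {(n, \<sigma>). \<sigma> \<in> lists \<Omega> \<and> (n, map Y \<sigma>) \<in> D}"
        using \<sigma>(1) p by (intro image_eqI[where x = "(fst (prod_decode p), \<sigma>)"]) auto
    next
      fix p assume "p \<in> encode ` {(n, \<sigma>). \<sigma> \<in> lists \<Omega> \<and> (n, map Y \<sigma>) \<in> D}"
      then obtain n \<sigma> where "p = encode (n, \<sigma>)" "\<sigma> \<in> lists \<Omega>" "(n, map Y \<sigma>) \<in> D" by blast
      then show "p \<in> dom h" using h[of \<sigma> n] by (simp add: domIff)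
    qed
  qed
  ultimately show ?thesis unfolding re_set_def by blast
qed

text \<open>
  The assumption \<open>n \<ge> 1\<close> matters: the empty tuple would be defined everywhere rather than on \<open>\<Omega>\<close>.
\<close>

lemma partial_recursive_on_tuple:
  fixes X :: "nat \<Rightarrow> 'a::finite_object \<Rightarrow> 'b::finite_object"
  assumes "n \<ge> 1" and "\<And>i. i \<in> {1..n} \<Longrightarrow> partial_recursive_on \<Omega> (X i)"
  shows "partial_recursive_on \<Omega> (\<lambda>a. tuple n (\<lambda>i. X i a))"
proof -
  have "\<forall>i\<in>{1..n}. \<exists>f. computable 1 (\<lambda>xs. f (xs ! 0)) \<and> dom f = encode ` \<Omega> \<and>
      (\<forall>a\<in>\<Omega>. f (encode a) = Some (encode (X i a)))"
    using assms(2) unfolding partial_recursive_on_def partial_recursive_iff_computable by blast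
  then obtain f where f: "\<And>i. i \<in> {1..n} \<Longrightarrow> computable 1 (\<lambda>xs. f i (xs ! 0))"
    and df: "\<And>i. i \<in> {1..n} \<Longrightarrow> dom (f i) = encode ` \<Omega>"
    and fX: "\<And>i a. i \<in> {1..n} \<Longrightarrow> a \<in> \<Omega> \<Longrightarrow> f i (encode a) = Some (encode (X i a))"
    by metis
  define h where "h x = map_option list_encode (those (map (\<lambda>i. f i x) [1..<Suc n]))" for x
  have "computable 1 (\<lambda>xs. map_option list_encode
      (those (map (\<lambda>F. F xs) (map (\<lambda>i xs. f i (xs ! 0)) [1..<Suc n]))))"
    by (rule computable_those) (use f in auto)
  then have "partial_recursive h"
    by (simp add: partial_recursive_iff_computable h_def comp_def)
  moreover have "dom h = encode ` \<Omega>"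
  proof -
    have "h x \<noteq> None \<longleftrightarrow> (\<forall>i\<in>{1..n}. x \<in> dom (f i))" for x
      by (auto simp: h_def those_map)
    then show ?thesis using df assms(1) by auto
  qed
  moreover have "h (encode a) = Some (encode (tuple n (\<lambda>i. X i a)))" if "a \<in> \<Omega>" for a
  proof -
    have "set [1..<Suc n] \<subseteq> dom (\<lambda>i. f i (encode a))" using fX that by auto
    then show ?thesis
      using fX that by (auto simp: h_def those_map encode_list_def tuple_def comp_def intro!: arg_cong[of _ _ list_encode])
  qed
  ultimately show ?thesis unfolding partial_recursive_on_def by blast
qed

text \<open>
  A number is accepted if it codes a list of the right length and the entry at each position
  is accepted by the machine for the corresponding alphabet.
\<close>

lemma re_set_product_alphabet:
  fixes \<Omega>' :: "nat \<Rightarrow> 'b::finite_object set"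
  assumes "\<And>i. i \<in> {1..n} \<Longrightarrow> re_set (\<Omega>' i)"
  shows "re_set (product_alphabet n \<Omega>')"
proof -
  have "\<forall>i\<in>{1..n}. \<exists>f. computable 1 (\<lambda>xs. f (xs ! 0)) \<and> dom f = encode ` \<Omega>' i"
    using assms unfolding re_set_def partial_recursive_iff_computable by blast
  then obtain f where f: "\<And>i. i \<in> {1..n} \<Longrightarrow> computable 1 (\<lambda>xs. f i (xs ! 0))"
    and df: "\<And>i. i \<in> {1..n} \<Longrightarrow> dom (f i) = encode ` \<Omega>' i"
    by metis
  define el where "el i x = hd_code (drop_code (i - 1) x)" for i x
  define G where "G x = map_option list_encode (those (map (\<lambda>i. f i (el i x)) [1..<Suc n]))" for x
  define c where "c x = (length_code x - n) + (n - length_code x)" for x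
  define h where "h x = Option.bind (if c x = 0 then Some (0 :: nat) else None) (\<lambda>_. G x)" for x
  have "computable 2 (\<lambda>xs. map_option list_encode
      (those (map (\<lambda>F. F xs) (map (\<lambda>i xs. f i (el i (xs ! 1))) [1..<Suc n]))))"
  proof (rule computable_those)
    fix F assume "F \<in> set (map (\<lambda>i xs. f i (el i (xs ! 1))) [1..<Suc n])"
    then obtain i where i: "i \<in> {1..n}" and F: "F = (\<lambda>xs. f i (el i (xs ! 1)))"
      by (force simp del: upt_Suc)
    show "computable 2 F" unfolding F el_def
      by (rule computable_apply[OF f[OF i]], intro code_intros total_computable_intros) auto
  qed
  then have G: "computable (Suc 1) (\<lambda>xs. G (xs ! 1))"
    by (simp add: G_def comp_def numeral_2_eq_2)
  have "computable 1 (\<lambda>xs. if c (xs ! 0) = 0 then Some 0 else None)"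
    unfolding c_def by (intro computable_guard total_computable_intros code_intros) auto
  from computable_bind[OF this G] have "partial_recursive h"
    by (simp add: partial_recursive_iff_computable h_def)
  moreover have "dom h = encode ` product_alphabet n \<Omega>'"
  proof -
    have h: "h x \<noteq> None \<longleftrightarrow> length_code x = n \<and> (\<forall>i\<in>{1..n}. el i x \<in> encode ` \<Omega>' i)" for x
    proof -
      have "set [1..<Suc n] \<subseteq> dom (\<lambda>i. f i (el i x)) \<longleftrightarrow> (\<forall>i\<in>{1..n}. el i x \<in> dom (f i))"
        by (auto simp: subset_iff simp del: upt_Suc)
      then have "G x \<noteq> None \<longleftrightarrow> (\<forall>i\<in>{1..n}. el i x \<in> encode ` \<Omega>' i)"
        using df by (simp add: G_def those_map del: upt_Suc)
      then show ?thesis by (simp add: h_def c_def) linarith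
    qed
    show ?thesis
    proof (intro set_eqI iffI)
      fix x assume "x \<in> dom h"
      then have len: "length_code x = n" and "\<forall>i\<in>{1..n}. el i x \<in> encode ` \<Omega>' i"
        using h by blast+
      then have "\<forall>i\<in>{1..n}. \<exists>b. b \<in> \<Omega>' i \<and> el i x = encode b" by blast
      then obtain b where b: "\<And>i. i \<in> {1..n} \<Longrightarrow> b i \<in> \<Omega>' i" "\<And>i. i \<in> {1..n} \<Longrightarrow> el i x = encode (b i)"
        by metis
      define l where "l = list_decode x"
      have x: "x = list_encode l" by (simp add: l_def)
      have "length l = n" using len by (simp add: x length_code_list_encode)
      then have "l = map encode (tuple n b)"
        using b(2)[of "Suc _"]
        by (intro nth_equalityI) (auto simp: tuple_def el_def x hd_drop_code_list_encode nth_append simp del: upt_Suc)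
      then have "x = encode (tuple n b)" by (simp add: x encode_list_def)
      moreover have "tuple n b \<in> product_alphabet n \<Omega>'"
        unfolding product_alphabet_def using b(1) by blast
      ultimately show "x \<in> encode ` product_alphabet n \<Omega>'" by blast
    next
      fix x assume "x \<in> encode ` product_alphabet n \<Omega>'"
      then obtain b where b: "\<And>i. i \<in> {1..n} \<Longrightarrow> b i \<in> \<Omega>' i" and x: "x = encode (tuple n b)"
        unfolding product_alphabet_def by blast
      have "el i x = encode (b i)" if "i \<in> {1..n}" for i
        using that by (auto simp: el_def x encode_list_def tuple_def hd_drop_code_list_encode simp del: upt_Suc)
      moreover have "length_code x = n" by (simp add: x encode_list_def tuple_def length_code_list_encode del: upt_Suc)
      ultimately show "x \<in> dom h" using h[of x] b by auto
    qed
  qed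
  ultimately show ?thesis unfolding re_set_def by blast
qed

text \<open>
  Running the machine for \<open>A\<close> first, and discarding its output, gives a total function on codes the
  exact domain \<open>A\<close>.
\<close>

lemma partial_recursive_on_total:
  fixes Z :: "'a::finite_object \<Rightarrow> 'b::finite_object"
  assumes "re_set A" and "total_computable 1 (\<lambda>xs. h (xs ! 0))"
    and "\<And>a. a \<in> A \<Longrightarrow> h (encode a) = encode (Z a)"
  shows "partial_recursive_on A Z"
proof -
  obtain f where f: "computable 1 (\<lambda>xs. f (xs ! 0))" and df: "dom f = encode ` A"
    using assms(1) by (auto simp: re_set_def partial_recursive_iff_computable)
  have "total_computable (Suc 1) (\<lambda>xs. h (xs ! 1))"
    by (intro total_computable_lift1[OF assms(2)] computable_proj) simp
  from computable_bind[OF f this]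
  have "partial_recursive (\<lambda>x. Option.bind (f x) (\<lambda>_. Some (h x)))"
    by (simp add: partial_recursive_iff_computable)
  moreover have "dom (\<lambda>x. Option.bind (f x) (\<lambda>_. Some (h x))) = encode ` A"
    unfolding df[symmetric] by (auto simp: bind_eq_Some_conv)
  moreover have "Option.bind (f (encode a)) (\<lambda>_. Some (h (encode a))) = Some (encode (Z a))" if "a \<in> A" for a
  proof -
    have "encode a \<in> dom f" using df that by blast
    then show ?thesis using assms(3)[OF that] by auto
  qed
  ultimately show ?thesis unfolding partial_recursive_on_def by blast
qed

lemma partial_recursive_on_indicators:
  fixes A :: "'a::finite_object set"
  assumes "re_set A"
  shows "partial_recursive_on A (\<lambda>b. of_bool (b = a) :: nat)"
    and "partial_recursive_on A (\<lambda>b. of_bool (b \<noteq> a) :: nat)"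
proof -
  let ?d = "\<lambda>x. (x - encode a) + (encode a - x)"
  have "?d (encode b) = 0 \<longleftrightarrow> encode b = encode a" for b :: 'a by linarith
  then have eq: "?d (encode b) = 0 \<longleftrightarrow> b = a" for b by (simp only: encode_eq_iff)
  have one_minus: "1 - x = of_bool (x = 0)" for x :: nat by (cases x) simp_all
  show "partial_recursive_on A (\<lambda>b. of_bool (b = a) :: nat)"
  proof (rule partial_recursive_on_total[OF assms, where h = "\<lambda>x. 1 - ?d x"])
    show "1 - ?d (encode b) = encode (of_bool (b = a) :: nat)" for b
      by (simp only: one_minus eq encode_nat_def of_bool_eq_0_iff)
  qed (intro total_computable_intros, auto)
  show "partial_recursive_on A (\<lambda>b. of_bool (b \<noteq> a) :: nat)"
  proof (rule partial_recursive_on_total[OF assms, where h = "\<lambda>x. 1 - (1 - ?d x)"])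
    show "1 - (1 - ?d (encode b)) = encode (of_bool (b \<noteq> a) :: nat)" for b
      by (simp only: one_minus eq encode_nat_def of_bool_eq_0_iff)
  qed (intro total_computable_intros, auto)
qed

text \<open>
  At level \<open>n\<close> these are the strings that stop at the first time \<open>k \<ge> K * n\<close> at which the average
  of the entries so far reaches \<open>p / q\<close>. Stopping at the first such time makes every level prefix-free,
  while the sequences extending one of its strings are exactly those whose average reaches \<open>p / q\<close>
  at some time from \<open>K * n\<close> on (for positive \<open>n\<close>, \<open>K\<close> and \<open>q\<close>).
\<close>

definition first_crossings :: "nat \<Rightarrow> nat \<Rightarrow> nat \<Rightarrow> (nat \<times> nat list) set" where
  "first_crossings K p q = {(n, \<sigma>). n \<ge> 1 \<and> K * n \<le> length \<sigma> \<and> p * length \<sigma> \<le> q * (\<Sum>i<length \<sigma>. \<sigma> ! i) \<and>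
     (\<forall>k<length \<sigma>. K * n \<le> k \<longrightarrow> \<not> p * k \<le> q * (\<Sum>i<k. \<sigma> ! i))}"

lemma Least_eq_iff_first:
  fixes R :: "nat \<Rightarrow> bool"
  shows "(\<exists>z. R z) \<and> (LEAST z. R z) = m \<longleftrightarrow> R m \<and> (\<forall>k<m. \<not> R k)"
proof
  assume "(\<exists>z. R z) \<and> (LEAST z. R z) = m"
  then show "R m \<and> (\<forall>k<m. \<not> R k)"
    using LeastI_ex[of R] not_less_Least[of _ R] by blast
next
  assume *: "R m \<and> (\<forall>k<m. \<not> R k)"
  then have "(LEAST z. R z) = m"
    by (intro Least_equality) (auto simp: not_less[symmetric])
  with * show "(\<exists>z. R z) \<and> (LEAST z. R z) = m" by blast
qed

text \<open>
  One searches for the first crossing time and then compares it with the length of the string.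
  Beyond the end of the string the sums continue with entries 0; a crossing found there
  is rejected by the comparison.
\<close>

lemma re_set_first_crossings: "re_set (first_crossings K p q)"
proof -
  define g where "g z x = (K * fst (prod_decode x) - z) + (p * z - q * sum_code z (snd (prod_decode x)))" for z x
  define S where "S x = (if \<exists>z. g z x = 0 then Some (LEAST z. g z x = 0) else None)" for x
  define c where "c z x = (1 - fst (prod_decode x)) +
      ((z - length_code (snd (prod_decode x))) + (length_code (snd (prod_decode x)) - z))" for z x
  define h where "h x = Option.bind (S x) (\<lambda>z. if c z x = 0 then Some (0 :: nat) else None)" for x
  have "total_computable (Suc 1) (\<lambda>xs. g (xs ! 0) (xs ! 1))"
    unfolding g_def by (intro total_computable_intros code_intros total_computable_sum_code) auto
  from computable_search[OF this] have S: "computable 1 (\<lambda>xs. S (xs ! 0))"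
    by (simp add: S_def cong: if_cong)
  have "computable (Suc 1) (\<lambda>xs. if c (xs ! 0) (xs ! 1) = 0 then Some 0 else None)"
    unfolding c_def by (intro computable_guard total_computable_intros code_intros) auto
  from computable_bind[OF S this] have "partial_recursive h"
    by (simp add: partial_recursive_iff_computable h_def)
  moreover have "dom h = encode ` first_crossings K p q"
  proof -
    have *: "h (encode (n, \<sigma>)) \<noteq> None \<longleftrightarrow> (n, \<sigma>) \<in> first_crossings K p q" for n and \<sigma> :: "nat list"
    proof -
      let ?x = "encode (n, \<sigma>)"
      have x: "prod_decode ?x = (n, list_encode \<sigma>)"
        by (simp add: encode_pair encode_nat_list encode_nat_def[of n])
      have g: "g k ?x = 0 \<longleftrightarrow> K * n \<le> k \<and> p * k \<le> q * (\<Sum>i<k. \<sigma> ! i)" if "k \<le> length \<sigma>" for k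
        using that by (simp add: g_def x sum_code_list_encode)
      have c: "c z ?x = 0 \<longleftrightarrow> n \<ge> 1 \<and> z = length \<sigma>" for z
        by (auto simp: c_def x length_code_list_encode)
      have "h ?x \<noteq> None \<longleftrightarrow> n \<ge> 1 \<and> (\<exists>z. g z ?x = 0) \<and> (LEAST z. g z ?x = 0) = length \<sigma>"
        by (auto simp: h_def S_def c)
      also have "(\<exists>z. g z ?x = 0) \<and> (LEAST z. g z ?x = 0) = length \<sigma> \<longleftrightarrow>
          g (length \<sigma>) ?x = 0 \<and> (\<forall>k<length \<sigma>. g k ?x \<noteq> 0)"
        by (rule Least_eq_iff_first)
      finally show ?thesis using g by (auto simp: first_crossings_def)
    qed
    have "\<exists>n \<sigma>. x = encode (n :: nat, \<sigma> :: nat list)" for x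
    proof -
      have "encode (fst (prod_decode x), list_decode (snd (prod_decode x))) = x"
        by (simp add: encode_pair encode_nat_def[of "fst _"] encode_nat_list)
      then show ?thesis by metis
    qed
    then show ?thesis using * by (fastforce simp: image_iff domIff)
  qed
  ultimately show ?thesis unfolding re_set_def by blast
qed

lemma prefix_free_first_crossings: "prefix_free {\<sigma>. (n, \<sigma>) \<in> first_crossings K p q}"
  unfolding prefix_free_def
proof (intro ballI impI)
  fix \<sigma> \<tau>
  assume \<sigma>: "\<sigma> \<in> {\<sigma>. (n, \<sigma>) \<in> first_crossings K p q}" and \<tau>: "\<tau> \<in> {\<sigma>. (n, \<sigma>) \<in> first_crossings K p q}"
    and "prefix \<sigma> \<tau>"
  then obtain \<rho> where \<rho>: "\<tau> = \<sigma> @ \<rho>" by (auto simp: prefix_def)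
  then have "(\<Sum>i<length \<sigma>. \<tau> ! i) = (\<Sum>i<length \<sigma>. \<sigma> ! i)" by (simp add: nth_append)
  then have "\<not> length \<sigma> < length \<tau>" using \<sigma> \<tau> by (auto simp: first_crossings_def)
  then show "\<sigma> = \<tau>" by (simp add: \<rho>)
qed

section \<open>Images and tail bounds of Bernoulli measures\<close>

lemma prob_space_bernoulli_measure: "prob_space (bernoulli_measure P)"
  unfolding bernoulli_measure_def by (intro prob_space_PiM measure_pmf.prob_space_axioms)

lemma space_bernoulli_measure: "space (bernoulli_measure P) = UNIV"
  by (simp add: bernoulli_measure_def space_PiM)

lemma measurable_map_seq:
  "(\<lambda>\<alpha>. Y \<circ> \<alpha>) \<in> measurable (bernoulli_measure P) (bernoulli_measure Q)"
  unfolding bernoulli_measure_def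
proof (rule measurable_PiM_single')
  fix k :: nat
  have "(\<lambda>\<alpha>. \<alpha> k) \<in> measurable (\<Pi>\<^sub>M k\<in>UNIV. measure_pmf P) (measure_pmf P)"
    by (rule measurable_component_singleton) simp
  then have "(\<lambda>\<alpha>. Y (\<alpha> k)) \<in> measurable (\<Pi>\<^sub>M k\<in>UNIV. measure_pmf P) (measure_pmf Q)"
    by (rule measurable_compose) simp
  then show "(\<lambda>\<alpha>. (Y \<circ> \<alpha>) k) \<in> measurable (\<Pi>\<^sub>M k\<in>UNIV. measure_pmf P) (measure_pmf Q)"
    by simp
qed (auto simp: space_PiM)

text \<open>
  Applying \<open>Y\<close> to each coordinate of an i.i.d. sequence with law \<open>P\<close> yields an i.i.d. sequence
  with law \<open>map_pmf Y P\<close>. It suffices to compare the two measures on finite-dimensional boxes.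
\<close>

lemma distr_bernoulli_measure_map:
  fixes Y :: "'a \<Rightarrow> 'b"
  shows "distr (bernoulli_measure P) (bernoulli_measure (map_pmf Y P)) (\<lambda>\<alpha>. Y \<circ> \<alpha>) =
    bernoulli_measure (map_pmf Y P)"
proof -
  let ?Q = "map_pmf Y P"
  interpret P: product_prob_space "\<lambda>_. measure_pmf P" "UNIV :: nat set" by unfold_locales
  interpret Q: product_prob_space "\<lambda>_. measure_pmf ?Q" "UNIV :: nat set" by unfold_locales
  show ?thesis
    unfolding bernoulli_measure_def[of ?Q]
  proof (rule Q.PiM_eq)
    fix J :: "nat set" and F :: "nat \<Rightarrow> 'b set"
    assume J: "finite J"
    let ?E = "prod_emb UNIV (\<lambda>_. measure_pmf ?Q) J (\<Pi>\<^sub>E j\<in>J. F j)"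
    have E: "?E \<in> sets (\<Pi>\<^sub>M k\<in>UNIV. measure_pmf ?Q)"
      by (rule sets_PiM_I[OF J]) auto
    have "emeasure (distr (bernoulli_measure P) (\<Pi>\<^sub>M k\<in>UNIV. measure_pmf ?Q) (\<lambda>\<alpha>. Y \<circ> \<alpha>)) ?E =
        emeasure (bernoulli_measure P) ((\<lambda>\<alpha>. Y \<circ> \<alpha>) -` ?E \<inter> space (bernoulli_measure P))"
      using measurable_map_seq[of Y P ?Q] E by (intro emeasure_distr) (simp_all add: bernoulli_measure_def)
    also have "(\<lambda>\<alpha>. Y \<circ> \<alpha>) -` ?E \<inter> space (bernoulli_measure P) =
        prod_emb UNIV (\<lambda>_. measure_pmf P) J (\<Pi>\<^sub>E j\<in>J. Y -` F j)"
      by (auto simp: space_bernoulli_measure prod_emb_def restrict_PiE_iff Pi_iff)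
    also have "emeasure (bernoulli_measure P) \<dots> = (\<Prod>j\<in>J. emeasure (measure_pmf P) (Y -` F j))"
      unfolding bernoulli_measure_def by (rule P.emeasure_PiM_emb) (use J in auto)
    also have "\<dots> = (\<Prod>j\<in>J. emeasure (measure_pmf ?Q) (F j))" by simp
    finally show "emeasure (distr (bernoulli_measure P) (\<Pi>\<^sub>M k\<in>UNIV. measure_pmf ?Q) (\<lambda>\<alpha>. Y \<circ> \<alpha>)) ?E =
        (\<Prod>j\<in>J. emeasure (measure_pmf ?Q) (F j))" .
  qed simp
qed

lemma measure_vimage_map_seq:
  fixes Y :: "'a \<Rightarrow> 'b"
  assumes "A \<in> sets (bernoulli_measure (map_pmf Y P))"
  shows "measure (bernoulli_measure P) {\<alpha>. Y \<circ> \<alpha> \<in> A} = measure (bernoulli_measure (map_pmf Y P)) A"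
    and "{\<alpha>. Y \<circ> \<alpha> \<in> A} \<in> sets (bernoulli_measure P)"
proof -
  have "measure (bernoulli_measure (map_pmf Y P)) A =
      measure (bernoulli_measure P) ((\<lambda>\<alpha>. Y \<circ> \<alpha>) -` A \<inter> space (bernoulli_measure P))"
    by (subst distr_bernoulli_measure_map[symmetric]) (rule measure_distr[OF measurable_map_seq assms])
  then show "measure (bernoulli_measure P) {\<alpha>. Y \<circ> \<alpha> \<in> A} = measure (bernoulli_measure (map_pmf Y P)) A"
    by (simp add: space_bernoulli_measure vimage_def)
  show "{\<alpha>. Y \<circ> \<alpha> \<in> A} \<in> sets (bernoulli_measure P)"
    using measurable_sets[OF measurable_map_seq[of Y P] assms] by (simp add: space_bernoulli_measure vimage_def)
qed

lemma indep_vars_coordinates: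
  "prob_space.indep_vars (bernoulli_measure P) (\<lambda>_. measure_pmf P) (\<lambda>k \<alpha>. \<alpha> k) UNIV"
proof -
  interpret P: product_prob_space "\<lambda>_. measure_pmf P" "UNIV :: nat set" by unfold_locales
  have "P.indep_vars (\<lambda>_. measure_pmf P) (\<lambda>k \<alpha>. \<alpha> k) UNIV"
    by (subst P.indep_vars_iff_distr_eq_PiM') (auto simp: P.PiM_component restrict_def)
  then show ?thesis by (simp add: bernoulli_measure_def)
qed

text \<open>
  Hoeffding's inequality for the first \<open>k\<close> coordinates. What matters later is only that the bound is
  geometric in \<open>k\<close>, so that it can be summed over all late \<open>k\<close>.
\<close>

lemma prob_average_exceeds:
  fixes B :: "nat pmf"
  assumes "set_pmf B \<subseteq> {0, 1}" and "\<epsilon> > 0" and "k \<ge> 1"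
  shows "measure (bernoulli_measure B) {\<gamma>. (\<Sum>i<k. real (\<gamma> i)) \<ge> (pmf B 1 + \<epsilon>) * k} \<le> exp (-2 * \<epsilon>\<^sup>2) ^ k"
proof -
  let ?M = "bernoulli_measure B"
  interpret M: prob_space ?M by (rule prob_space_bernoulli_measure)
  interpret P: product_prob_space "\<lambda>_. measure_pmf B" "UNIV :: nat set" by unfold_locales
  have coord: "(\<lambda>\<gamma>. \<gamma> i) \<in> measurable ?M (measure_pmf B)" for i
    unfolding bernoulli_measure_def by (rule measurable_component_singleton) simp
  have meas: "(\<lambda>\<gamma>. real (\<gamma> i)) \<in> borel_measurable ?M" for i
    by (rule measurable_compose[OF coord]) simp
  have distr: "distr ?M (measure_pmf B) (\<lambda>\<gamma>. \<gamma> i) = measure_pmf B" for i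
    unfolding bernoulli_measure_def by (rule P.PiM_component) simp
  have exp: "M.expectation (\<lambda>\<gamma>. real (\<gamma> i)) = pmf B 1" for i
  proof -
    have "M.expectation (\<lambda>\<gamma>. real (\<gamma> i)) = measure_pmf.expectation B real"
      by (subst distr[of i, symmetric], subst integral_distr[OF coord]) auto
    also have "\<dots> = (\<Sum>b\<in>{0, 1}. real b * pmf B b)"
      by (rule integral_measure_pmf_real) (use assms(1) in auto)
    finally show ?thesis by simp
  qed
  interpret Hoeffding_ineq ?M "{..<k}" "\<lambda>i \<gamma>. real (\<gamma> i)" "\<lambda>_. 0" "\<lambda>_. 1" "pmf B 1 * k"
  proof unfold_locales
    have "M.indep_vars (\<lambda>_. measure_pmf B) (\<lambda>i \<gamma>. \<gamma> i) {..<k}"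
      by (rule M.indep_vars_subset[OF indep_vars_coordinates]) simp
    then show "M.indep_vars (\<lambda>_. borel) (\<lambda>i \<gamma>. real (\<gamma> i)) {..<k}"
      by (rule M.indep_vars_compose2) simp
    show "AE \<gamma> in ?M. real (\<gamma> i) \<in> {0..1}" for i
    proof -
      have "AE \<gamma> in ?M. \<gamma> i \<in> {0, 1}"
        unfolding bernoulli_measure_def
        by (rule P.AE_component) (use assms(1) in \<open>auto simp: AE_measure_pmf_iff\<close>)
      then show ?thesis by eventually_elim auto
    qed
    show "pmf B 1 * k \<equiv> \<Sum>i<k. M.expectation (\<lambda>\<gamma>. real (\<gamma> i))"
      by (simp add: exp mult.commute)
  qed simp
  have "M.prob {\<gamma> \<in> space ?M. (\<Sum>i<k. real (\<gamma> i)) \<ge> pmf B 1 * k + \<epsilon> * k} \<le>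
      exp (-2 * (\<epsilon> * k)\<^sup>2 / (\<Sum>i<k. (1 - 0)\<^sup>2))"
    by (rule Hoeffding_ineq_ge) (use assms in auto)
  also have "-2 * (\<epsilon> * k)\<^sup>2 / (\<Sum>i<k. (1 - 0)\<^sup>2) = k * (-2 * \<epsilon>\<^sup>2)"
    using assms(3) by (simp add: power2_eq_square field_simps)
  also have "exp (k * (-2 * \<epsilon>\<^sup>2)) = exp (-2 * \<epsilon>\<^sup>2) ^ k"
    by (rule exp_of_nat_mult)
  finally show ?thesis
    by (simp add: space_bernoulli_measure distrib_right)
qed

lemma prob_some_late_average_exceeds:
  fixes B :: "nat pmf"
  assumes B: "set_pmf B \<subseteq> {0, 1}" and \<epsilon>: "\<epsilon> > 0" and "N \<ge> 1"
  defines "\<rho> \<equiv> exp (-2 * \<epsilon>\<^sup>2)"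
  shows "measure (bernoulli_measure B) {\<gamma>. \<exists>k\<ge>N. (\<Sum>i<k. real (\<gamma> i)) \<ge> (pmf B 1 + \<epsilon>) * k} \<le> \<rho> ^ N / (1 - \<rho>)"
proof -
  let ?M = "bernoulli_measure B"
  interpret M: prob_space ?M by (rule prob_space_bernoulli_measure)
  \<comment> \<open>A union bound over the times \<open>N + j\<close>; the geometric series gives the denominator.\<close>
  define A where "A j = {\<gamma>. (\<Sum>i<N+j. real (\<gamma> i)) \<ge> (pmf B 1 + \<epsilon>) * (N + j)}" for j
  have eq: "{\<gamma>. \<exists>k\<ge>N. (\<Sum>i<k. real (\<gamma> i)) \<ge> (pmf B 1 + \<epsilon>) * k} = (\<Union>j. A j)"
    by (auto simp: A_def le_iff_add)
  have coord: "(\<lambda>\<gamma>. real (\<gamma> i)) \<in> borel_measurable ?M" for i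
    unfolding bernoulli_measure_def
    by (rule measurable_compose[OF measurable_component_singleton]) auto
  have A: "A j \<in> sets ?M" for j
  proof -
    have "{\<gamma> \<in> space ?M. (pmf B 1 + \<epsilon>) * (N + j) \<le> (\<Sum>i<N+j. real (\<gamma> i))} \<in> sets ?M"
      using coord by measurable
    then show ?thesis by (simp add: A_def space_bernoulli_measure)
  qed
  have \<rho>: "0 < \<rho>" "\<rho> < 1" using \<epsilon> by (auto simp: \<rho>_def)
  have bound: "M.prob (A j) \<le> \<rho> ^ N * \<rho> ^ j" for j
    using prob_average_exceeds[OF B \<epsilon>, of "N + j"] assms(3)
    by (simp add: A_def \<rho>_def power_add)
  have sums: "(\<lambda>j. \<rho> ^ N * \<rho> ^ j) sums (\<rho> ^ N * (1 / (1 - \<rho>)))"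
    using \<rho> by (intro sums_mult geometric_sums) auto
  have summ: "summable (\<lambda>j. M.prob (A j))"
    by (rule summable_comparison_test'[OF sums_summable[OF sums], of 0]) (use bound in auto)
  have "M.prob (\<Union>j. A j) \<le> (\<Sum>j. M.prob (A j))"
    using A summ by (intro M.finite_measure_subadditive_countably) auto
  also have "\<dots> \<le> (\<Sum>j. \<rho> ^ N * \<rho> ^ j)"
    by (intro suminf_le bound summ sums_summable[OF sums])
  also have "\<dots> = \<rho> ^ N / (1 - \<rho>)" using sums_unique[OF sums] by simp
  finally show "M.prob {\<gamma>. \<exists>k\<ge>N. (\<Sum>i<k. real (\<gamma> i)) \<ge> (pmf B 1 + \<epsilon>) * k} \<le> \<rho> ^ N / (1 - \<rho>)"
    unfolding eq .
qed

section \<open>Martin-Loef random sequences\<close>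

lemma initial_segment_comp: "initial_segment (Y \<circ> \<alpha>) m = map Y (initial_segment \<alpha> m)"
  by (simp add: initial_segment_def)

text \<open>
  A test that \<open>Y \<circ> \<alpha>\<close> fails can be pulled back along \<open>Y\<close> to a test that \<open>\<alpha>\<close> fails. The pulled back
  set is recursively enumerable since \<open>Y\<close> is partial recursive with domain \<open>\<Omega>\<close>, it stays prefix-free since
  \<open>map Y\<close> preserves lengths and prefixes, and its measure does not grow since \<open>\<lambda>\<alpha>. Y \<circ> \<alpha>\<close> carries the
  Bernoulli measure of \<open>P\<close> to that of \<open>map_pmf Y P\<close>.
\<close>

theorem martin_loef_random_map:
  fixes Y :: "'a::finite_object \<Rightarrow> 'b::finite_object"
  assumes random: "martin_loef_random \<Omega> P \<alpha>"
    and Y: "Y \<in> \<Omega> \<rightarrow> \<Omega>'" and rec: "partial_recursive_on \<Omega> Y"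
  shows "martin_loef_random \<Omega>' (map_pmf Y P) (Y \<circ> \<alpha>)"
  unfolding martin_loef_random_def
proof (intro conjI allI impI)
  have \<alpha>: "\<alpha> \<in> infinite_seqs \<Omega>" using random by (simp add: martin_loef_random_def)
  then show "Y \<circ> \<alpha> \<in> infinite_seqs \<Omega>'" using Y by (auto simp: infinite_seqs_def)
  fix D assume D: "martin_loef_test \<Omega>' (map_pmf Y P) D"
  define C where "C = {(n, \<sigma>). \<sigma> \<in> lists \<Omega> \<and> (n, map Y \<sigma>) \<in> D}"
  have cyl: "cylinder \<Omega> {\<sigma>. (n, \<sigma>) \<in> C} =
      infinite_seqs \<Omega> \<inter> {\<beta>. Y \<circ> \<beta> \<in> cylinder \<Omega>' {\<sigma>. (n, \<sigma>) \<in> D}}" for n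
  proof -
    have "initial_segment \<beta> m \<in> lists \<Omega>" "Y \<circ> \<beta> \<in> infinite_seqs \<Omega>'" if "\<beta> \<in> infinite_seqs \<Omega>" for \<beta> m
      using that Y by (auto simp: infinite_seqs_def initial_segment_def)
    then show ?thesis by (auto simp: cylinder_def C_def initial_segment_comp)
  qed
  have "martin_loef_test \<Omega> P C"
    unfolding martin_loef_test_def
  proof (intro conjI allI impI)
    show "C \<subseteq> {1..} \<times> lists \<Omega>" using D by (auto simp: C_def martin_loef_test_def)
    show "re_set C"
      unfolding C_def using D by (intro re_set_preimage_map[OF rec]) (simp add: martin_loef_test_def)
    fix n :: nat assume n: "n \<ge> 1"
    \<comment> \<open>Comparable strings have equal images, hence equal lengths, hence are equal.\<close>
    have pf: "prefix_free {\<sigma>. (n, \<sigma>) \<in> D}" using D n by (simp add: martin_loef_test_def)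
    show "prefix_free {\<sigma>. (n, \<sigma>) \<in> C}"
      unfolding prefix_free_def
    proof (intro ballI impI)
      fix \<sigma> \<tau> assume "\<sigma> \<in> {\<sigma>. (n, \<sigma>) \<in> C}" "\<tau> \<in> {\<sigma>. (n, \<sigma>) \<in> C}" and pre: "prefix \<sigma> \<tau>"
      then have "map Y \<sigma> = map Y \<tau>"
        using pf map_mono_prefix[OF pre, of Y] by (auto simp: prefix_free_def C_def)
      then have "length \<sigma> = length \<tau>" by (rule map_eq_imp_length_eq)
      with pre show "\<sigma> = \<tau>" by (auto simp: prefix_def)
    qed
    interpret prob_space "bernoulli_measure P" by (rule prob_space_bernoulli_measure)
    let ?A = "cylinder \<Omega>' {\<sigma>. (n, \<sigma>) \<in> D}"
    have "prob (cylinder \<Omega> {\<sigma>. (n, \<sigma>) \<in> C}) \<le> prob {\<beta>. Y \<circ> \<beta> \<in> ?A}"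
      unfolding cyl by (intro finite_measure_mono measure_vimage_map_seq cylinder_in_sets) auto
    also have "\<dots> = measure (bernoulli_measure (map_pmf Y P)) ?A"
      by (intro measure_vimage_map_seq cylinder_in_sets)
    also have "\<dots> < (1/2) ^ n" using D n by (simp add: martin_loef_test_def)
    finally show "prob (cylinder \<Omega> {\<sigma>. (n, \<sigma>) \<in> C}) < (1/2) ^ n" .
  qed
  then obtain n where "n \<ge> 1" "\<alpha> \<notin> cylinder \<Omega> {\<sigma>. (n, \<sigma>) \<in> C}"
    using random by (auto simp: martin_loef_random_def)
  then show "\<exists>n\<ge>1. Y \<circ> \<alpha> \<notin> cylinder \<Omega>' {\<sigma>. (n, \<sigma>) \<in> D}"
    unfolding cyl using \<alpha> by blast
qed

lemma countable_re_sets: "countable {A :: 'a::finite_object set. re_set A}"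
proof -
  have "{f. partial_recursive f} = range (\<lambda>c x. eval_recf c [x])"
    by (auto simp: partial_recursive_def fun_eq_iff)
  then have "countable {f. partial_recursive f}" by simp
  moreover have "{A :: 'a set. re_set A} \<subseteq> (\<lambda>f. encode -` dom f) ` {f. partial_recursive f}"
    by (force simp: re_set_def encode_eq_iff image_iff)
  ultimately show ?thesis by (meson countable_image countable_subset)
qed

text \<open>
  There are only countably many tests, and each of them is failed by a null set of sequences;
  hence almost every sequence is random.
\<close>

theorem ex_martin_loef_random:
  fixes \<Omega> :: "'a::finite_object set"
  assumes "P \<in> discrete_prob_spaces \<Omega>"
  shows "\<exists>\<alpha>. martin_loef_random \<Omega> P \<alpha>"
proof -
  let ?M = "bernoulli_measure P"
  interpret M: prob_space ?M by (rule prob_space_bernoulli_measure)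
  interpret P: product_prob_space "\<lambda>_. measure_pmf P" "UNIV :: nat set" by unfold_locales
  have "AE \<alpha> in ?M. \<alpha> k \<in> \<Omega>" for k
    unfolding bernoulli_measure_def
    using assms by (intro P.AE_component) (auto simp: discrete_prob_spaces_def AE_measure_pmf_iff)
  then have "AE \<alpha> in ?M. \<alpha> \<in> infinite_seqs \<Omega>"
    by (simp add: infinite_seqs_def AE_all_countable)
  moreover have "AE \<alpha> in ?M. \<forall>C\<in>{C. martin_loef_test \<Omega> P C}. \<exists>n\<ge>1. \<alpha> \<notin> cylinder \<Omega> {\<sigma>. (n, \<sigma>) \<in> C}"
  proof (rule AE_ball_countable')
    show "countable {C. martin_loef_test \<Omega> P C}"
      by (rule countable_subset[OF _ countable_re_sets]) (auto simp: martin_loef_test_def)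
    fix C assume "C \<in> {C. martin_loef_test \<Omega> P C}"
    then have C: "M.prob (cylinder \<Omega> {\<sigma>. (n, \<sigma>) \<in> C}) < (1/2) ^ n" if "n \<ge> 1" for n
      using that by (auto simp: martin_loef_test_def)
    let ?N = "\<Inter>n. cylinder \<Omega> {\<sigma>. (Suc n, \<sigma>) \<in> C}"
    have N: "?N \<in> sets ?M" by (intro sets.countable_INT' cylinder_in_sets) (auto simp: cylinder_in_sets)
    have le: "M.prob ?N \<le> (1/2) ^ n" for n
    proof -
      have "M.prob ?N \<le> M.prob (cylinder \<Omega> {\<sigma>. (Suc n, \<sigma>) \<in> C})"
        by (intro M.finite_measure_mono cylinder_in_sets) auto
      also have "\<dots> \<le> (1/2) ^ Suc n" using C[of "Suc n"] by simp
      also have "\<dots> \<le> (1/2) ^ n" by simp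
      finally show ?thesis .
    qed
    have "(\<lambda>n. (1/2 :: real) ^ n) \<longlonglongrightarrow> 0" by (rule LIMSEQ_realpow_zero) auto
    then have "M.prob ?N \<le> 0"
      by (rule LIMSEQ_le_const) (use le in auto)
    then have "M.prob ?N = 0" using measure_nonneg[of ?M ?N] by linarith
    then have "?N \<in> null_sets ?M" using N by (simp add: M.emeasure_eq_measure null_setsI)
    from AE_not_in[OF this] show "AE \<alpha> in ?M. \<exists>n\<ge>1. \<alpha> \<notin> cylinder \<Omega> {\<sigma>. (n, \<sigma>) \<in> C}"
      by eventually_elim (auto intro: Suc_le_mono)
  qed
  ultimately have "AE \<alpha> in ?M. martin_loef_random \<Omega> P \<alpha>"
    by eventually_elim (auto simp: martin_loef_random_def)
  moreover have "\<not> (AE \<alpha> in ?M. False)" by simp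
  ultimately show ?thesis by (metis (mono_tags, lifting) eventually_mono)
qed

text \<open>
  One half of an effective law of large numbers. The distribution \<open>B\<close> enters the test only through
  the rational threshold \<open>p / q\<close> and the integer \<open>K\<close>, which are constants of the algorithm; this is why
  the test is recursively enumerable for arbitrary real \<open>pmf B 1\<close>.
\<close>

lemma martin_loef_random_average_less:
  fixes B :: "nat pmf" and p q :: nat
  assumes random: "martin_loef_random UNIV B \<gamma>" and B: "set_pmf B \<subseteq> {0, 1}"
    and q: "q > 0" and less: "pmf B 1 < p / q"
  shows "\<exists>N. \<forall>k\<ge>N. q * (\<Sum>i<k. \<gamma> i) < p * k"
proof -
  let ?M = "bernoulli_measure B"
  interpret M: prob_space ?M by (rule prob_space_bernoulli_measure)
  define \<epsilon> where "\<epsilon> = p / q - pmf B 1"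
  define \<rho> where "\<rho> = exp (-2 * \<epsilon>\<^sup>2)"
  have \<epsilon>: "\<epsilon> > 0" using less by (simp add: \<epsilon>_def)
  then have \<rho>: "0 < \<rho>" "\<rho> < 1" by (auto simp: \<rho>_def)
  \<comment> \<open>Then level \<open>n\<close> has measure at most \<open>\<rho> ^ (K * n) / (1 - \<rho>) < (1/2) ^ n\<close>, uniformly in \<open>n\<close>.\<close>
  obtain K where K: "\<rho> ^ K < (1 - \<rho>) / 2"
    using real_arch_pow_inv[of "(1 - \<rho>) / 2" \<rho>] \<rho> by auto
  have "K \<ge> 1" using K \<rho> by (cases K) auto
  define L where "L n = {\<beta> :: nat \<Rightarrow> nat. \<exists>k\<ge>K * n. p * k \<le> q * (\<Sum>i<k. \<beta> i)}" for n
  have L_eq: "L n = {\<beta>. \<exists>k\<ge>K * n. (\<Sum>i<k. real (\<beta> i)) \<ge> (pmf B 1 + \<epsilon>) * k}" for n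
  proof -
    have "p * k \<le> q * s \<longleftrightarrow> real s \<ge> (pmf B 1 + \<epsilon>) * k" for k s :: nat
    proof -
      have "p * k \<le> q * s \<longleftrightarrow> real p * real k \<le> real q * real s"
        by (metis of_nat_le_iff of_nat_mult)
      also have "\<dots> \<longleftrightarrow> real p / real q * real k \<le> real s"
        using q by (simp add: field_simps)
      finally show ?thesis by (simp add: \<epsilon>_def)
    qed
    then show ?thesis by (simp add: L_def)
  qed
  have cyl: "cylinder UNIV {\<sigma>. (n, \<sigma>) \<in> first_crossings K p q} = L n" if n: "n \<ge> 1" for n
  proof (intro set_eqI iffI)
    fix \<beta> assume "\<beta> \<in> cylinder UNIV {\<sigma>. (n, \<sigma>) \<in> first_crossings K p q}"
    then obtain m where "(n, initial_segment \<beta> m) \<in> first_crossings K p q" by (auto simp: cylinder_def)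
    then show "\<beta> \<in> L n" by (auto simp: first_crossings_def L_def initial_segment_def intro!: exI[of _ m])
  next
    fix \<beta> assume "\<beta> \<in> L n"
    then have ex: "\<exists>k. K * n \<le> k \<and> p * k \<le> q * (\<Sum>i<k. \<beta> i)" by (simp add: L_def)
    define m where "m = (LEAST k. K * n \<le> k \<and> p * k \<le> q * (\<Sum>i<k. \<beta> i))"
    have m: "K * n \<le> m \<and> p * m \<le> q * (\<Sum>i<m. \<beta> i)"
      unfolding m_def by (rule LeastI_ex[OF ex])
    have min: "\<not> (K * n \<le> k \<and> p * k \<le> q * (\<Sum>i<k. \<beta> i))" if "k < m" for k
      using that unfolding m_def by (rule not_less_Least)
    have "(n, initial_segment \<beta> m) \<in> first_crossings K p q"
      using m min n by (auto simp: first_crossings_def initial_segment_def)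
    then show "\<beta> \<in> cylinder UNIV {\<sigma>. (n, \<sigma>) \<in> first_crossings K p q}"
      by (auto simp: cylinder_def infinite_seqs_def)
  qed
  have "martin_loef_test UNIV B (first_crossings K p q)"
    unfolding martin_loef_test_def
  proof (intro conjI allI impI re_set_first_crossings prefix_free_first_crossings)
    show "first_crossings K p q \<subseteq> {1..} \<times> lists UNIV" by (auto simp: first_crossings_def)
    fix n :: nat assume n: "n \<ge> 1"
    have "M.prob (L n) \<le> \<rho> ^ (K * n) / (1 - \<rho>)"
      unfolding L_eq \<rho>_def using prob_some_late_average_exceeds[OF B \<epsilon>, of "K * n"] n \<open>K \<ge> 1\<close> by simp
    also have "\<dots> < ((1 - \<rho>) / 2) ^ n / (1 - \<rho>)"
      unfolding power_mult using K \<rho> n by (intro divide_strict_right_mono power_strict_mono) auto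
    also have "\<dots> = (1 - \<rho>) ^ n / (1 - \<rho>) * (1/2) ^ n"
      by (simp add: power_divide)
    also have "\<dots> \<le> 1 * (1/2) ^ n"
    proof (intro mult_right_mono)
      have "(1 - \<rho>) ^ n \<le> (1 - \<rho>) ^ 1" using \<rho> n by (intro power_decreasing) auto
      then show "(1 - \<rho>) ^ n / (1 - \<rho>) \<le> 1" using \<rho> by simp
    qed simp
    finally show "M.prob (cylinder UNIV {\<sigma>. (n, \<sigma>) \<in> first_crossings K p q}) < (1/2) ^ n"
      using cyl[OF n] by simp
  qed
  then obtain n where n: "n \<ge> 1" "\<gamma> \<notin> L n"
    using random cyl unfolding martin_loef_random_def by blast
  then have "\<forall>k\<ge>K * n. q * (\<Sum>i<k. \<gamma> i) < p * k" by (auto simp: L_def not_le[symmetric])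
  then show ?thesis by blast
qed

text \<open>
  A random sequence determines its distribution, as the limiting frequency of each symbol \<open>a\<close>. If
  \<open>Q\<close> gave \<open>a\<close> less weight than some rational \<open>p / q\<close> and \<open>R\<close> gave it more, then in late initial segments the
  symbol \<open>a\<close> would have frequency below \<open>p / q\<close>, and the other symbols together frequency below
  \<open>1 - p / q\<close>, though these frequencies add up to 1. Passing to the 0-1 sequences that record \<open>a\<close> and
  its complement reduces both statements to an upper bound for averages.
\<close>

theorem martin_loef_random_pmf_unique:
  fixes A :: "'a::finite_object set"
  assumes re: "re_set A" and R: "martin_loef_random A R \<beta>" and Q: "martin_loef_random A Q \<beta>"
  shows "R = Q"
proof -
  have *: "pmf R a \<le> pmf Q a" if R: "martin_loef_random A R \<beta>" and Q: "martin_loef_random A Q \<beta>" for R Q a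
  proof (rule ccontr)
    assume "\<not> pmf R a \<le> pmf Q a"
    then obtain r where "r \<in> \<rat>" and r: "pmf Q a < r" "r < pmf R a"
      using Rats_dense_in_real[of "pmf Q a" "pmf R a"] by auto
    moreover have "r \<ge> 0" using r(1) pmf_nonneg[of Q a] by linarith
    ultimately obtain p q :: nat where q: "q > 0" and r_eq: "r = p / q"
      using Rats_abs_nat_div_natE[of r] by (metis abs_of_nonneg neq0_conv)
    have "r < 1" using r(2) pmf_le_1[of R a] by linarith
    then have pq: "p \<le> q" using q by (simp add: r_eq)
    \<comment> \<open>\<open>?S\<close> records the occurrences of \<open>a\<close> and \<open>?T\<close> all others, so their sums up to \<open>k\<close> add up to \<open>k\<close>.\<close>
    let ?S = "\<lambda>b. of_bool (b = a) :: nat" and ?T = "\<lambda>b. of_bool (b \<noteq> a) :: nat"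
    have "martin_loef_random UNIV (map_pmf ?S Q) (?S \<circ> \<beta>)"
      by (rule martin_loef_random_map[OF Q _ partial_recursive_on_indicators(1)[OF re]]) simp
    moreover have "set_pmf (map_pmf ?S Q) \<subseteq> {0, 1}" by auto
    moreover have "pmf (map_pmf ?S Q) 1 < p / q"
      using r(1) by (simp add: pmf_map vimage_def r_eq measure_pmf_single)
    ultimately obtain N1 where N1: "\<And>k. k \<ge> N1 \<Longrightarrow> q * (\<Sum>i<k. (?S \<circ> \<beta>) i) < p * k"
      using martin_loef_random_average_less[of "map_pmf ?S Q" "?S \<circ> \<beta>" q p] q by blast
    have "martin_loef_random UNIV (map_pmf ?T R) (?T \<circ> \<beta>)"
      by (rule martin_loef_random_map[OF R _ partial_recursive_on_indicators(2)[OF re]]) simp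
    moreover have "set_pmf (map_pmf ?T R) \<subseteq> {0, 1}" by auto
    moreover have "pmf (map_pmf ?T R) 1 < (q - p :: nat) / q"
    proof -
      have "pmf (map_pmf ?T R) 1 = measure_pmf.prob R (UNIV - {a})"
        by (auto simp: pmf_map vimage_def intro!: arg_cong[of _ _ "measure_pmf.prob R"])
      also have "\<dots> = 1 - pmf R a"
        using measure_pmf.prob_compl[of "{a}" R] by (simp add: measure_pmf_single)
      also have "\<dots> < 1 - r" using r(2) by simp
      also have "\<dots> = (q - p :: nat) / q" using pq q by (simp add: r_eq of_nat_diff field_simps)
      finally show ?thesis .
    qed
    ultimately obtain N2 where N2: "\<And>k. k \<ge> N2 \<Longrightarrow> q * (\<Sum>i<k. (?T \<circ> \<beta>) i) < (q - p) * k"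
      using martin_loef_random_average_less[of "map_pmf ?T R" "?T \<circ> \<beta>" q "q - p"] q by blast
    define k where "k = max N1 N2"
    have "(\<Sum>i<k. (?S \<circ> \<beta>) i) + (\<Sum>i<k. (?T \<circ> \<beta>) i) = (\<Sum>i<k. 1)"
      unfolding sum.distrib[symmetric] by (rule sum.cong) auto
    then have "q * (\<Sum>i<k. (?S \<circ> \<beta>) i) + q * (\<Sum>i<k. (?T \<circ> \<beta>) i) = q * k"
      by (simp add: distrib_left[symmetric])
    moreover have "p * k + (q - p) * k = q * k" using pq by (simp add: distrib_right[symmetric])
    ultimately show False using N1[of k] N2[of k] by (simp add: k_def)
  qed
  show ?thesis by (rule pmf_eqI) (use *[OF R Q] *[OF Q R] in \<open>auto intro: antisym\<close>)
qed

section \<open>Independence as equality of distributions\<close>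

lemma tuple_eq_iff: "tuple n x = tuple n y \<longleftrightarrow> (\<forall>i\<in>{1..n}. x i = y i)"
  by (auto simp: tuple_def simp del: upt_Suc)

text \<open>
  Independence compares the two distributions at tuples with entries in the alphabets; at all other
  lists both of them vanish, by the support of \<open>P\<close> and the range of the \<open>X i\<close>.
\<close>

lemma independent_rvs_iff_product_space:
  assumes P: "set_pmf P \<subseteq> \<Omega>" and X: "\<And>i. i \<in> {1..n} \<Longrightarrow> X i \<in> \<Omega> \<rightarrow> \<Omega>' i"
  shows "independent_rvs n \<Omega> P \<Omega>' X \<longleftrightarrow>
    map_pmf (\<lambda>a. tuple n (\<lambda>i. X i a)) P = product_space n (\<lambda>i. map_pmf (X i) P)" (is "_ \<longleftrightarrow> ?J = ?Q")
proof -
  have prob: "measure_pmf.prob P {a \<in> \<Omega>. R a} = measure_pmf.prob P {a. R a}" for R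
    by (rule measure_prob_cong_0) (use P in \<open>auto simp: set_pmf_iff\<close>)
  have joint: "pmf ?J (tuple n x) = measure_pmf.prob P {a \<in> \<Omega>. \<forall>i\<in>{1..n}. X i a = x i}" for x
    by (simp add: pmf_map vimage_def tuple_eq_iff prob)
  have marg: "pmf (map_pmf (X i) P) b = measure_pmf.prob P {a \<in> \<Omega>. X i a = b}" for i b
    by (simp add: pmf_map vimage_def prob)
  have prod: "pmf ?Q (tuple n x) = (\<Prod>i\<in>{1..n}. measure_pmf.prob P {a \<in> \<Omega>. X i a = x i})" for x
    by (simp only: pmf_product_space marg)
  have at_tuples: "?J = ?Q" if eq: "\<And>x. pmf ?J (tuple n x) = pmf ?Q (tuple n x)"
  proof (rule pmf_eqI)
    fix w
    show "pmf ?J w = pmf ?Q w"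
    proof (cases "\<exists>x. w = tuple n x")
      case False
      then have "w \<notin> set_pmf ?J" "w \<notin> set_pmf ?Q" by (auto simp: product_space_def)
      then show ?thesis by (simp only: set_pmf_iff not_not)
    qed (use eq in auto)
  qed
  have outside: "pmf ?J (tuple n x) = pmf ?Q (tuple n x)" if i: "i \<in> {1..n}" and "x i \<notin> \<Omega>' i" for x i
  proof -
    have e: "{a \<in> \<Omega>. X i a = x i} = {}" using that X[OF i] by (fastforce simp: Pi_iff)
    then have "{a \<in> \<Omega>. \<forall>i\<in>{1..n}. X i a = x i} = {}" using i by blast
    then have "pmf ?J (tuple n x) = 0" unfolding joint by (simp only: measure_empty)
    moreover have "pmf ?Q (tuple n x) = 0"
      unfolding prod
    proof (rule prod_zero)
      show "\<exists>i\<in>{1..n}. measure_pmf.prob P {a \<in> \<Omega>. X i a = x i} = 0"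
        using i by (rule rev_bexI) (simp only: e measure_empty)
    qed simp
    ultimately show ?thesis by simp
  qed
  show ?thesis
  proof
    assume ind: "independent_rvs n \<Omega> P \<Omega>' X"
    show "?J = ?Q"
    proof (rule at_tuples)
      fix x show "pmf ?J (tuple n x) = pmf ?Q (tuple n x)"
        using ind outside[of _ x] unfolding independent_rvs_def joint prod by blast
    qed
  next
    assume "?J = ?Q"
    then have "pmf ?J (tuple n x) = pmf ?Q (tuple n x)" for x by simp
    then show "independent_rvs n \<Omega> P \<Omega>' X" unfolding independent_rvs_def joint prod by blast
  qed
qed

theorem theorem45:
  fixes \<Omega> :: "'a::finite_object set"
    and \<Omega>' :: "nat \<Rightarrow> 'b::finite_object set"
    and P :: "'a pmf"
    and X :: "nat \<Rightarrow> 'a \<Rightarrow> 'b"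
    and n :: nat
  assumes "n \<ge> 1"
    and "re_set \<Omega>" and "infinite \<Omega>"
    and "\<And>i. i \<in> {1..n} \<Longrightarrow> re_set (\<Omega>' i)"
    and "\<And>i. i \<in> {1..n} \<Longrightarrow> infinite (\<Omega>' i)"
    and "P \<in> discrete_prob_spaces \<Omega>"
    and "\<And>i. i \<in> {1..n} \<Longrightarrow> X i \<in> \<Omega> \<rightarrow> \<Omega>' i"
    and "\<And>i. i \<in> {1..n} \<Longrightarrow> partial_recursive_on \<Omega> (X i)"
  shows "(independent_rvs n \<Omega> P \<Omega>' X \<longleftrightarrow>
           (\<forall>\<alpha>. ensemble \<Omega> P \<alpha> \<longrightarrow>
              independent_ensembles n \<Omega>' (\<lambda>i. map_pmf (X i) P) (\<lambda>i. X i \<circ> \<alpha>))) \<and>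
         ((\<forall>\<alpha>. ensemble \<Omega> P \<alpha> \<longrightarrow>
              independent_ensembles n \<Omega>' (\<lambda>i. map_pmf (X i) P) (\<lambda>i. X i \<circ> \<alpha>)) \<longleftrightarrow>
           (\<exists>\<alpha>. ensemble \<Omega> P \<alpha> \<and>
              independent_ensembles n \<Omega>' (\<lambda>i. map_pmf (X i) P) (\<lambda>i. X i \<circ> \<alpha>)))"
proof -
  let ?Y = "\<lambda>a. tuple n (\<lambda>i. X i a)"
  let ?Q = "product_space n (\<lambda>i. map_pmf (X i) P)"
  let ?A = "product_alphabet n \<Omega>'"
  have comp: "product_seq n (\<lambda>i. X i \<circ> \<alpha>) = ?Y \<circ> \<alpha>" for \<alpha>
    by (auto simp: product_seq_def fun_eq_iff)
  have joint: "martin_loef_random ?A (map_pmf ?Y P) (?Y \<circ> \<alpha>)" if "ensemble \<Omega> P \<alpha>" for \<alpha>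
  proof (rule martin_loef_random_map)
    show "martin_loef_random \<Omega> P \<alpha>" using that by (simp add: ensemble_def)
    show "?Y \<in> \<Omega> \<rightarrow> ?A"
    proof (rule funcsetI)
      fix a assume "a \<in> \<Omega>"
      then have "\<forall>i\<in>{1..n}. X i a \<in> \<Omega>' i" using assms(7) by blast
      then show "?Y a \<in> ?A" unfolding product_alphabet_def by blast
    qed
    show "partial_recursive_on \<Omega> ?Y" by (rule partial_recursive_on_tuple[OF assms(1,8)])
  qed
  have marginal: "ensemble (\<Omega>' i) (map_pmf (X i) P) (X i \<circ> \<alpha>)" if "ensemble \<Omega> P \<alpha>" "i \<in> {1..n}" for \<alpha> i
    using that unfolding ensemble_def by (intro martin_loef_random_map[where \<Omega> = \<Omega>] assms(7,8))
  have iff: "independent_ensembles n \<Omega>' (\<lambda>i. map_pmf (X i) P) (\<lambda>i. X i \<circ> \<alpha>) \<longleftrightarrow>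
      martin_loef_random ?A ?Q (?Y \<circ> \<alpha>)" if "ensemble \<Omega> P \<alpha>" for \<alpha>
    using marginal[OF that] by (simp add: independent_ensembles_def comp ensemble_def)
  have ind: "independent_rvs n \<Omega> P \<Omega>' X \<longleftrightarrow> map_pmf ?Y P = ?Q"
    using assms(6) by (intro independent_rvs_iff_product_space assms(7)) (auto simp: discrete_prob_spaces_def)
  \<comment> \<open>\<open>?Y \<circ> \<alpha>\<close> is random for its joint law in any case, and it is random for at most one law.
     So the condition does not depend on \<open>\<alpha>\<close>.\<close>
  have key: "martin_loef_random ?A ?Q (?Y \<circ> \<alpha>) \<longleftrightarrow> map_pmf ?Y P = ?Q" if "ensemble \<Omega> P \<alpha>" for \<alpha>
    using joint[OF that] martin_loef_random_pmf_unique[OF re_set_product_alphabet[OF assms(4)] joint[OF that]]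
    by metis
  obtain \<alpha> where "ensemble \<Omega> P \<alpha>"
    using ex_martin_loef_random[OF assms(6)] by (auto simp: ensemble_def)
  then show ?thesis using ind iff key by metis
qed

end
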